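(* Given any parameter $\ell>1$ and positive integer $n$, there exist a $\frac1n$-separated subset $\{\xi_j\}_{j=1}^{m_n}$ of $\Omega$ with respect to the metric $\rho_\Omega$ and a sequence of polynomials $\{P_j\}_{j=1}^{m_n}\subset\Pi_{c_0n}^{d+1}$ such that for every $\xi\in\Omega$, $$\sum_{j=1}^{m_n}P_j(\xi)=1\quad\text{and}\quad|P_j(\xi)|\le C_1\big(1+n\rho_\Omega(\xi,\xi_j)\big)^{-\ell},\quad j=1,2,\dots,m_n,$$ where the constants $c_0$ and $C_1$ depend only on $d$ and $\ell$.
   Context: Let $d\ge1$ be an integer, $\|\cdot\|$ the Euclidean norm, $\mathrm{dist}(\xi,E)=\inf_{\eta\in E}\|\xi-\eta\|$. A bounded domain $\Omega_0\subset\mathbb{R}^{d+1}$ is $C^2$ if there exist $\delta>0$, $M>0$ and a finite cover of its boundary $\Gamma$ by connected open sets $U_1,\dots,U_J$ such that (i) for every $x\in\Omega_0$ with $\mathrm{dist}(x,\Gamma)<\delta$ there is $j$ with $x\in U_j$ and $\mathrm{dist}(x,\partial U_j)>\delta$; (ii) for each $j$ there is a Cartesian coordinate system $(\xi_{j,1},\dots,\xi_{j,d+1})$ in $U_j$ in which $\Omega_0\cap U_j$ is represented by $\xi_{j,d+1}\le f_j(\xi_{j,1},\dots,\xi_{j,d})$ with $f_j:\mathbb{R}^d\to\mathbb{R}$ of class $C^2$ and $\max_{i,k}\|\partial_i\partial_kf_j\|_\infty\le M$. $\Omega$ is the closure of an open, connected, bounded $C^2$-domain in $\mathbb{R}^{d+1}$,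 with boundary $\Gamma=\partial\Omega$. The metric on $\Omega$ is $\rho_\Omega(\xi,\eta)=\|\xi-\eta\|+\big|\sqrt{\mathrm{dist}(\xi,\Gamma)}-\sqrt{\mathrm{dist}(\eta,\Gamma)}\big|$. A set $\Lambda$ in a metric space $(X,\rho)$ is $\varepsilon$-separated, for some $\varepsilon>0$, if $\rho(\omega,\omega')\ge\varepsilon$ for any two distinct $\omega,\omega'\in\Lambda$. $\Pi_s^{d+1}$ is the space of real polynomials on $\mathbb{R}^{d+1}$ of total degree at most $s$.
   Formalization: C_1 may depend on Ω (not on n); c_0 depends only on d, ℓ. A C_1 uniform in Ω is impossible (ellipsoids with semi-axes R,1,…,1, n=1, R→∞). In the charts the open domain Ω_0 is given by a strict inequality below the graph, since ≤ would admit no domain. *)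

theory Defs
  imports "HOL-Analysis.Analysis"
begin

definition partial_deriv :: "'d::finite \<Rightarrow> (real^'d \<Rightarrow> real) \<Rightarrow> real^'d \<Rightarrow> real"
  where "partial_deriv i f y = frechet_derivative f (at y) (axis i 1)"

definition class_C2 :: "(real^'d::finite \<Rightarrow> real) \<Rightarrow> bool"
  where "class_C2 f \<longleftrightarrow>
    (\<forall>y. f differentiable (at y)) \<and>
    (\<forall>k y. partial_deriv k f differentiable (at y)) \<and>
    (\<forall>i k. continuous_on UNIV (partial_deriv i (partial_deriv k f)))"

text \<open>
  The space of dimension \<open>d + 1\<close> is \<open>(real^'d) \<times> real\<close> with \<open>d = CARD('d) \<ge> 1\<close>; the norm of the
  product type is the Euclidean one.  A Cartesian coordinate system is \<open>x \<mapsto> L x + a\<close> with \<open>L\<close>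
  orthogonal: \<open>fst (L x + a)\<close> holds the first \<open>d\<close> coordinates of \<open>x\<close> and \<open>snd (L x + a)\<close> the last
  one.

  A domain is open, so the part of it inside a chart is the strict subgraph of \<open>f\<close>; requiring
  \<open>\<le>\<close> for the open set itself would make it relatively clopen in the connected set \<open>U\<close>.  The
  non-strict inequality describes its closure (\<open>closure_in_graph_chart\<close> below).
\<close>

definition graph_chart ::
    "real \<Rightarrow> ((real^'d::finite) \<times> real) set \<Rightarrow> ((real^'d) \<times> real) set \<Rightarrow> bool"
  where "graph_chart M D U \<longleftrightarrow>
    (\<exists>(L :: (real^'d) \<times> real \<Rightarrow> (real^'d) \<times> real) a f.
       orthogonal_transformation L \<and> class_C2 f \<and>
       (\<forall>i k y. \<bar>partial_deriv i (partial_deriv k f) y\<bar> \<le> M) \<and>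
       D \<inter> U = {x \<in> U. snd (L x + a) < f (fst (L x + a))})"

text \<open>
  In the next definition, \<open>infdist\<close> to the frontier of a set \<open>U\<close> with empty frontier is \<open>0\<close>.  This
  is harmless: such a \<open>U\<close> is empty or the whole space, and the whole space is not a chart of a
  bounded set.
\<close>

definition C2_domain :: "((real^'d::finite) \<times> real) set \<Rightarrow> bool"
  where "C2_domain D \<longleftrightarrow>
    open D \<and> connected D \<and> bounded D \<and> D \<noteq> {} \<and>
    (\<exists>\<delta>>0. \<exists>M>0. \<exists>\<U>.
       finite \<U> \<and> (\<forall>U\<in>\<U>. open U \<and> connected U) \<and> frontier D \<subseteq> \<Union>\<U> \<and>
       (\<forall>x\<in>D. infdist x (frontier D) < \<delta> \<longrightarrow>
          (\<exists>U\<in>\<U>. x \<in> U \<and> infdist x (frontier U) > \<delta>)) \<and>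
       (\<forall>U\<in>\<U>. graph_chart M D U))"

definition rho :: "'a::euclidean_space set \<Rightarrow> 'a \<Rightarrow> 'a \<Rightarrow> real"
  where "rho \<Omega> x y =
    norm (x - y) + \<bar>sqrt (infdist x (frontier \<Omega>)) - sqrt (infdist y (frontier \<Omega>))\<bar>"

definition separated_set :: "('a \<Rightarrow> 'a \<Rightarrow> real) \<Rightarrow> real \<Rightarrow> 'a set \<Rightarrow> bool"
  where "separated_set \<rho> \<epsilon> \<Lambda> \<longleftrightarrow> (\<forall>x\<in>\<Lambda>. \<forall>y\<in>\<Lambda>. x \<noteq> y \<longrightarrow> \<rho> x y \<ge> \<epsilon>)"

text \<open>
  Exponents of monomials of total degree at most \<open>s\<close> in the coordinates with respect to the standard
  basis.  The restriction to extensional functions with values in \<open>{..s}\<close> only makes the set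
  evidently finite.
\<close>

definition exponents :: "nat \<Rightarrow> ('a::euclidean_space \<Rightarrow> nat) set"
  where "exponents s = {\<alpha> \<in> Basis \<rightarrow>\<^sub>E {..s}. (\<Sum>b\<in>Basis. \<alpha> b) \<le> s}"

definition poly_space :: "nat \<Rightarrow> ('a::euclidean_space \<Rightarrow> real) set"
  where "poly_space s =
    {p. \<exists>c. \<forall>x. p x = (\<Sum>\<alpha>\<in>exponents s. c \<alpha> * (\<Prod>b\<in>Basis. (x \<bullet> b) ^ \<alpha> b))}"

lemma class_C2_continuous: "class_C2 f \<Longrightarrow> continuous_on UNIV f"
  by (meson class_C2_def continuous_at_imp_continuous_on differentiable_imp_continuous_within)

lemma closure_in_graph_chart:
  fixes f :: "real^'d::finite \<Rightarrow> real"
    and L :: "(real^'d) \<times> real \<Rightarrow> (real^'d) \<times> real"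
  assumes "open U" "orthogonal_transformation L" "class_C2 f"
    and D: "D \<inter> U = {x \<in> U. snd (L x + a) < f (fst (L x + a))}"
  shows "closure D \<inter> U = {x \<in> U. snd (L x + a) \<le> f (fst (L x + a))}"
proof -
  have lin: "linear L" and cf: "continuous_on UNIV f"
    using assms by (auto simp: orthogonal_transformation_def class_C2_continuous)
  define g where "g = (\<lambda>x. f (fst (L x + a)) - snd (L x + a))"
  have cL: "continuous_on UNIV L"
    using lin by (simp add: linear_continuous_on linear_conv_bounded_linear)
  have cg: "continuous_on UNIV g"
    unfolding g_def
    by (intro continuous_intros continuous_on_compose2[OF cf] cL) auto
  have D': "D \<inter> U = {x \<in> U. g x > 0}"
    using D by (auto simp: g_def)
  have "g x \<ge> 0" if "x \<in> closure D" "x \<in> U" for x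
  proof -
    have "x \<in> closure (D \<inter> U)"
      using that open_Int_closure_subset[OF \<open>open U\<close>, of D] by (auto simp: Int_commute)
    moreover have "closure (D \<inter> U) \<subseteq> {x. g x \<ge> 0}"
      by (rule closure_minimal) (use D' cg in \<open>auto intro!: closed_Collect_le continuous_intros\<close>)
    ultimately show ?thesis by auto
  qed
  moreover have "x \<in> closure D" if x: "x \<in> U" "g x \<ge> 0" for x
  proof -
    obtain v where v: "L v = (0, - 1)"
      using orthogonal_transformation_surj[OF assms(2)] by (metis surjD)
    define h where "h = (\<lambda>t::real. x + t *\<^sub>R v)"
    have gh: "g (h t) = g x + t" for t
      by (simp add: g_def h_def v linear_add[OF lin] linear_scale[OF lin])
    have lim: "((\<lambda>n. h (1 / real (Suc n))) \<longlongrightarrow> h 0) sequentially"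
      unfolding h_def by (intro tendsto_intros LIMSEQ_Suc[OF lim_1_over_n])
    moreover have "eventually (\<lambda>n. h (1 / real (Suc n)) \<in> U) sequentially"
      using lim x \<open>open U\<close> by (intro topological_tendstoD) (auto simp: h_def)
    then have "eventually (\<lambda>n. h (1 / real (Suc n)) \<in> D) sequentially"
    proof eventually_elim
      case (elim n)
      have "g (h (1 / real (Suc n))) > 0"
        using x(2) by (simp add: gh add_nonneg_pos)
      then show ?case using elim D' by blast
    qed
    ultimately have "h 0 \<in> closure D"
      by (intro Lim_in_closed_set[of "closure D" _ sequentially])
         (auto elim: eventually_mono intro: closure_subset[THEN subsetD])
    then show ?thesis by (simp add: h_def)
  qed
  ultimately show ?thesis by (auto simp: g_def)
qed

end

theory Submission
  imports Defs
begin

text \<open>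
  The polynomials are products of one-dimensional ones, and the curvature of the boundary enters
  only through a quadratic substitution.

  In one dimension, normalized powers of the Dirichlet kernel, translated along a grid on the circle
  and symmetrized, are polynomials in \<open>x = cos \<theta>\<close>, nonnegative on \<open>{-1..1}\<close>, with sum \<open>1\<close>.  Their
  moments of order \<open>2 * q\<close> are bounded at scale \<open>1 / n\<close> in the metric of the circle, hence in both
  \<open>\<bar>x - y\<bar>\<close> and \<open>\<bar>sqrt (1 - x) - sqrt (1 - y)\<bar>\<close> (\<open>localized_partition_interval\<close>).  Tensor
  products over the coordinates give a partition of unity \<open>E k\<close> around points \<open>\<eta> k\<close> which resolves
  the Euclidean distance \<open>1 / n\<close>.  It does not resolve differences of \<open>sqrt d\<close>, where \<open>d\<close> is the
  distance to the boundary: near the boundary these are much larger than differences of points.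

  To resolve \<open>sqrt d\<close> as well, each \<open>E k\<close> is split by a one-dimensional partition evaluated at
  \<open>t k\<close>, where \<open>t k\<close> is a quadratic polynomial with
  \<open>\<bar>sqrt (t k x) - sqrt (d x)\<bar> \<le> C * norm (x - \<eta> k)\<close> on the domain
  (\<open>sqrt_dist_quadratic_models\<close>).  An error proportional to \<open>norm (x - \<eta> k)\<close> is harmless because
  the decay of \<open>E k\<close> absorbs it.  One polynomial \<open>t k\<close> for each \<open>k\<close> is enough, and it must be
  nonnegative on the whole domain, since the one-dimensional polynomials are controlled only there.

  These quadratic polynomials exist because every boundary point is touched by an interior and an
  exterior ball of a fixed radius (\<open>C2_domain_two_sided_ball_condition\<close>).  The distances to the
  centres of these balls bound \<open>d\<close> from both sides, and at the points of the common normal near the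
  boundary both bounds have the same linear part, with quadratic errors.

  The products \<open>Q (k, i)\<close> of the two partitions are finally added up in groups: each has a centre in
  the domain where its two localizing quantities are minimal, and a maximal separated subset of the
  centres collects the others (\<open>regroup_partition_by_separated_centres\<close>).  The bounds are on
  weighted sums of all \<open>Q (k, i)\<close>, so it does not matter how many centres are collected by one point.
\<close>

section \<open>Polynomials of bounded total degree\<close>

lemma finite_exponents: "finite (exponents s :: ('a::euclidean_space \<Rightarrow> nat) set)"
  unfolding exponents_def by (rule finite_subset[OF _ finite_PiE[of Basis "\<lambda>_. {..s}"]]) auto

lemma poly_space_add:
  assumes "p \<in> poly_space s" "q \<in> poly_space s"
  shows "(\<lambda>x. p x + q x) \<in> poly_space s"
proof -
  obtain c d where
    "\<forall>x. p x = (\<Sum>\<alpha>\<in>exponents s. c \<alpha> * (\<Prod>b\<in>Basis. (x \<bullet> b) ^ \<alpha> b))"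
    "\<forall>x. q x = (\<Sum>\<alpha>\<in>exponents s. d \<alpha> * (\<Prod>b\<in>Basis. (x \<bullet> b) ^ \<alpha> b))"
    using assms unfolding poly_space_def by blast
  then have "\<forall>x. p x + q x =
      (\<Sum>\<alpha>\<in>exponents s. (c \<alpha> + d \<alpha>) * (\<Prod>b\<in>Basis. (x \<bullet> b) ^ \<alpha> b))"
    by (simp add: sum.distrib distrib_right)
  then show ?thesis unfolding poly_space_def by (intro CollectI exI)
qed

lemma poly_space_cmult:
  assumes "p \<in> poly_space s"
  shows "(\<lambda>x. r * p x) \<in> poly_space s"
proof -
  obtain c where
    "\<forall>x. p x = (\<Sum>\<alpha>\<in>exponents s. c \<alpha> * (\<Prod>b\<in>Basis. (x \<bullet> b) ^ \<alpha> b))"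
    using assms unfolding poly_space_def by blast
  then have "\<forall>x. r * p x =
      (\<Sum>\<alpha>\<in>exponents s. (r * c \<alpha>) * (\<Prod>b\<in>Basis. (x \<bullet> b) ^ \<alpha> b))"
    by (simp add: sum_distrib_left mult.assoc)
  then show ?thesis unfolding poly_space_def by (intro CollectI exI)
qed

lemma poly_space_monomial:
  fixes \<beta> :: "'a::euclidean_space \<Rightarrow> nat"
  assumes "(\<Sum>b\<in>Basis. \<beta> b) \<le> s"
  shows "(\<lambda>x. \<Prod>b\<in>Basis. (x \<bullet> b) ^ \<beta> b) \<in> poly_space s"
proof -
  define \<beta>' where "\<beta>' = restrict \<beta> Basis"
  have "\<beta> b \<le> s" if "b \<in> Basis" for b
    using member_le_sum[OF that, of \<beta>] assms by simp
  then have mem: "\<beta>' \<in> exponents s"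
    using assms by (auto simp: exponents_def \<beta>'_def)
  have "\<forall>x. (\<Prod>b\<in>Basis. (x \<bullet> b) ^ \<beta> b) = (\<Sum>\<alpha>\<in>exponents s.
      (if \<alpha> = \<beta>' then 1 else 0) * (\<Prod>b\<in>Basis. (x \<bullet> b) ^ \<alpha> b))"
  proof
    fix x :: 'a
    have "(\<Sum>\<alpha>\<in>exponents s. (if \<alpha> = \<beta>' then 1 else 0) * (\<Prod>b\<in>Basis. (x \<bullet> b) ^ \<alpha> b)) =
        (\<Sum>\<alpha>\<in>exponents s. if \<alpha> = \<beta>' then (\<Prod>b\<in>Basis. (x \<bullet> b) ^ \<alpha> b) else 0)"
      by (intro sum.cong) auto
    also have "\<dots> = (\<Prod>b\<in>Basis. (x \<bullet> b) ^ \<beta>' b)"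
      using mem by (simp add: finite_exponents)
    finally show "(\<Prod>b\<in>Basis. (x \<bullet> b) ^ \<beta> b) = (\<Sum>\<alpha>\<in>exponents s.
      (if \<alpha> = \<beta>' then 1 else 0) * (\<Prod>b\<in>Basis. (x \<bullet> b) ^ \<alpha> b))"
      by (simp add: \<beta>'_def)
  qed
  then show ?thesis unfolding poly_space_def by (intro CollectI exI)
qed

lemma poly_space_const: "(\<lambda>x. r) \<in> poly_space s"
  using poly_space_cmult[OF poly_space_monomial[of "\<lambda>_. 0" s], of r] by simp

lemma poly_space_sum:
  assumes "\<And>i. i \<in> I \<Longrightarrow> f i \<in> poly_space s"
  shows "(\<lambda>x. \<Sum>i\<in>I. f i x) \<in> poly_space s"
  using assms
  by (induction I rule: infinite_finite_induct) (auto intro: poly_space_add poly_space_const)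

lemma poly_space_coord:
  assumes "b \<in> Basis" "s \<ge> 1"
  shows "(\<lambda>x. x \<bullet> b) \<in> poly_space s"
proof -
  have "(\<lambda>x. \<Prod>c\<in>Basis. (x \<bullet> c) ^ (if c = b then 1 else 0)) \<in> poly_space s"
    by (rule poly_space_monomial) (use assms in simp)
  also have "(\<lambda>x. \<Prod>c\<in>Basis. (x \<bullet> c) ^ (if c = b then 1 else 0)) = (\<lambda>x. x \<bullet> b)"
    using assms by (simp add: if_distrib[of "\<lambda>k. _ ^ k"] cong: if_cong)
  finally show ?thesis .
qed

lemma poly_space_inner: "s \<ge> 1 \<Longrightarrow> (\<lambda>x. v \<bullet> x) \<in> poly_space s"
  by (subst euclidean_inner)
    (auto intro!: poly_space_sum poly_space_cmult poly_space_coord)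

lemma poly_space_mult:
  fixes p q :: "'a::euclidean_space \<Rightarrow> real"
  assumes "p \<in> poly_space s" "q \<in> poly_space s'" "s + s' \<le> S"
  shows "(\<lambda>x. p x * q x) \<in> poly_space S"
proof -
  obtain c d where cd:
    "\<forall>x. p x = (\<Sum>\<alpha>\<in>exponents s. c \<alpha> * (\<Prod>b\<in>Basis. (x \<bullet> b) ^ \<alpha> b))"
    "\<forall>x. q x = (\<Sum>\<alpha>\<in>exponents s'. d \<alpha> * (\<Prod>b\<in>Basis. (x \<bullet> b) ^ \<alpha> b))"
    using assms unfolding poly_space_def by blast
  have "(\<lambda>x. p x * q x) = (\<lambda>x. \<Sum>\<alpha>\<in>exponents s. \<Sum>\<beta>\<in>exponents s'.
      (c \<alpha> * d \<beta>) * (\<Prod>b\<in>Basis. (x \<bullet> b) ^ (\<alpha> b + \<beta> b)))"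
    by (simp add: cd sum_product power_add prod.distrib mult_ac)
  also have "\<dots> \<in> poly_space S"
    by (intro poly_space_sum poly_space_cmult poly_space_monomial)
       (use assms(3) in \<open>auto simp: exponents_def sum.distrib\<close>)
  finally show ?thesis .
qed

lemma poly_space_mono: "p \<in> poly_space s \<Longrightarrow> s \<le> s' \<Longrightarrow> p \<in> poly_space s'"
  using poly_space_mult[OF poly_space_const[of 1 0], of p s s'] by simp

lemma poly_space_power: "p \<in> poly_space s \<Longrightarrow> (\<lambda>x. p x ^ k) \<in> poly_space (s * k)"
  by (induction k) (auto intro: poly_space_const poly_space_mult)

lemma poly_space_prod:
  assumes "finite I" "\<And>i. i \<in> I \<Longrightarrow> f i \<in> poly_space s"
  shows "(\<lambda>x. \<Prod>i\<in>I. f i x) \<in> poly_space (card I * s)"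
  using assms
proof (induction rule: finite_induct)
  case empty
  show ?case by (simp add: poly_space_const)
next
  case (insert i F)
  have "(\<lambda>x. f i x * (\<Prod>i\<in>F. f i x)) \<in> poly_space (card (insert i F) * s)"
    by (rule poly_space_mult[of _ s _ "card F * s"]) (use insert in auto)
  then show ?case using insert by simp
qed

lemma poly_space_compose:
  assumes "p \<in> poly_space s" "degree h \<le> k"
  shows "(\<lambda>x. poly h (p x)) \<in> poly_space (s * k)"
  unfolding poly_altdef
  by (intro poly_space_sum poly_space_cmult poly_space_mono[OF poly_space_power[OF assms(1)]])
     (use assms(2) in auto)

section \<open>A localized polynomial partition of unity on an interval\<close>

lemma chebyshev_poly_exists: "\<exists>p :: real poly. degree p \<le> k \<and> (\<forall>\<theta>. poly p (cos \<theta>) = cos (real k * \<theta>))"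
proof (induction k rule: induct_nat_012)
  case 0
  show ?case by (rule exI[of _ 1]) simp
next
  case 1
  show ?case by (rule exI[of _ "[:0, 1:]"]) simp
next
  case (ge2 k)
  then obtain p p' :: "real poly" where
    p: "degree p \<le> k" "\<forall>\<theta>. poly p (cos \<theta>) = cos (real k * \<theta>)" and
    p': "degree p' \<le> Suc k" "\<forall>\<theta>. poly p' (cos \<theta>) = cos (real (Suc k) * \<theta>)"
    by blast
  define r where "r = smult 2 ([:0, 1:] * p') - p"
  have "degree (smult 2 ([:0, 1:] * p')) \<le> Suc (Suc k)"
    using degree_mult_le[of "[:0, 1:]" p'] p'(1) by (simp add: degree_pCons_eq_if)
  then have "degree r \<le> Suc (Suc k)"
    unfolding r_def using p(1) by (intro degree_diff_le) auto
  moreover have "poly r (cos \<theta>) = cos (real (Suc (Suc k)) * \<theta>)" for \<theta>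
  proof -
    have "cos (real (Suc (Suc k)) * \<theta>) + cos (real k * \<theta>) =
        cos (real (Suc k) * \<theta> + \<theta>) + cos (real (Suc k) * \<theta> - \<theta>)"
      by (simp add: algebra_simps)
    also have "\<dots> = 2 * cos \<theta> * cos (real (Suc k) * \<theta>)"
      by (simp add: cos_add cos_diff)
    finally show ?thesis
      using p(2) p'(2) by (simp add: r_def algebra_simps)
  qed
  ultimately show ?case by blast
qed

text \<open>
  As the coefficients are real, only cosines remain.  For \<open>\<phi> = \<theta> - \<tau>\<close> the average over \<open>\<theta>\<close> and
  \<open>- \<theta>\<close> is then a polynomial in \<open>cos \<theta>\<close>.
\<close>

lemma norm_trig_poly_squared:
  "(cmod (\<Sum>k\<le>s. of_real (a k) * cis \<phi> ^ k))\<^sup>2 =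
   (\<Sum>k\<le>s. \<Sum>k'\<le>s. a k * a k' * cos ((real k - real k') * \<phi>))"
proof -
  let ?S = "\<Sum>k\<le>s. of_real (a k) * cis \<phi> ^ k"
  have "complex_of_real ((cmod ?S)\<^sup>2) = ?S * cnj ?S"
    by (rule complex_norm_square)
  also have "\<dots> = (\<Sum>k\<le>s. \<Sum>k'\<le>s. of_real (a k * a k') * cis ((real k - real k') * \<phi>))"
    by (simp add: sum_product Complex.DeMoivre cis_cnj cis_mult algebra_simps)
  finally have "(cmod ?S)\<^sup>2 =
      Re (\<Sum>k\<le>s. \<Sum>k'\<le>s. of_real (a k * a k') * cis ((real k - real k') * \<phi>))"
    by (metis Re_complex_of_real)
  then show ?thesis by simp
qed

lemma sum_cos_grid:
  assumes "0 < p" "p < M"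
  shows "(\<Sum>j<M. cos (real p * (\<theta> - 2 * pi * real j / real M))) = 0"
proof -
  define w where "w = cis (- (2 * pi * real p / real M))"
  have "w ^ M = cis (- (2 * pi * real p))"
    using assms by (simp add: w_def Complex.DeMoivre)
  also have "\<dots> = 1"
    using cis_multiple_2pi[of "- real p"] by (simp add: mult_ac)
  finally have wM: "w ^ M = 1" .
  have "w \<noteq> 1"
  proof
    assume "w = 1"
    then have "cos (2 * pi * real p / real M) = 1"
      by (simp add: w_def complex_eq_iff)
    then obtain i :: int where "2 * pi * real p / real M = of_int i * 2 * pi"
      by (auto simp: cos_one_2pi_int)
    then have "real p = of_int i * real M"
      using assms by (simp add: field_simps)
    then have "int p = i * int M"
      by (metis of_int_eq_iff of_int_mult of_int_of_nat_eq)
    then have "int M dvd int p" by simp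
    then show False
      using assms by (simp add: nat_dvd_not_less)
  qed
  then have "(\<Sum>j<M. w ^ j) = 0"
    using wM by (simp add: geometric_sum)
  then have "0 = Re (cis (real p * \<theta>) * (\<Sum>j<M. w ^ j))" by simp
  also have "\<dots> = (\<Sum>j<M. Re (cis (real p * (\<theta> - 2 * pi * real j / real M))))"
    by (simp add: sum_distrib_left w_def Complex.DeMoivre cis_mult algebra_simps)
  finally show ?thesis by simp
qed

text \<open>
  A grid of more than \<open>s\<close> points integrates the squared modulus of a trigonometric polynomial of
  degree \<open>s\<close> exactly, for every shift \<open>\<theta>\<close>.  Exactness is what makes the grid translates of a kernel add
  up to a constant.
\<close>

lemma grid_parseval:
  assumes "s < M"
  shows "(\<Sum>j<M. (cmod (\<Sum>k\<le>s. of_real (a k) * cis (\<theta> - 2 * pi * real j / real M) ^ k))\<^sup>2) =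
    real M * (\<Sum>k\<le>s. (a k)\<^sup>2)"
proof -
  have inner: "(\<Sum>j<M. cos ((real k - real k') * (\<theta> - 2 * pi * real j / real M))) =
      (if k = k' then real M else 0)" if "k \<le> s" "k' \<le> s" for k k'
  proof (cases k k' rule: linorder_cases)
    case less
    have "cos ((real k - real k') * x) = cos (real (k' - k) * x)" for x
      using less cos_minus[of "(real k - real k') * x"] by (simp add: of_nat_diff algebra_simps)
    then show ?thesis
      using less that assms sum_cos_grid[of "k' - k" M \<theta>] by simp
  next
    case greater
    then show ?thesis
      using that assms sum_cos_grid[of "k - k'" M \<theta>] by (simp add: of_nat_diff)
  qed simp
  have "(\<Sum>j<M. \<Sum>k\<le>s. \<Sum>k'\<le>s.
        a k * a k' * cos ((real k - real k') * (\<theta> - 2 * pi * real j / real M))) =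
      (\<Sum>k\<le>s. \<Sum>j<M. \<Sum>k'\<le>s.
        a k * a k' * cos ((real k - real k') * (\<theta> - 2 * pi * real j / real M)))"
    by (rule sum.swap)
  also have "\<dots> = (\<Sum>k\<le>s. \<Sum>k'\<le>s. a k * a k' *
        (\<Sum>j<M. cos ((real k - real k') * (\<theta> - 2 * pi * real j / real M))))"
    unfolding sum_distrib_left
    by (rule sum.cong[OF refl], rule sum.swap)
  also have "\<dots> = (\<Sum>k\<le>s. \<Sum>k'\<le>s. a k * a k' * (if k = k' then real M else 0))"
    by (intro sum.cong refl) (simp add: inner)
  also have "\<dots> = (\<Sum>k\<le>s. a k * a k * real M)"
    by (intro sum.cong refl) (simp add: if_distrib cong: if_cong)
  finally show ?thesis
    by (simp only: norm_trig_poly_squared) (simp add: power2_eq_square sum_distrib_left mult_ac)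
qed

text \<open>
  Only the existence of real coefficients matters: they make the squared modulus of the power a cosine
  polynomial, and their sum is \<open>n ^ m\<close>.
\<close>

lemma geometric_sum_power_coeffs:
  "\<exists>a :: nat \<Rightarrow> real. \<forall>u :: complex.
     (\<Sum>k<n. u ^ k) ^ m = (\<Sum>k\<le>m * (n - 1). of_real (a k) * u ^ k)"
proof -
  define D where "D = (\<Sum>k<n. monom 1 k :: real poly)"
  define F where "F = map_poly complex_of_real (D ^ m)"
  have hom: "map_poly complex_of_real (p * q) = map_poly of_real p * map_poly of_real q" for p q
    by (intro poly_eqI) (simp add: coeff_map_poly coeff_mult)
  have Fm: "map_poly complex_of_real (p ^ m) = map_poly of_real p ^ m" for p and m
    by (induction m) (simp_all add: hom map_poly_1)
  have "map_poly complex_of_real D = (\<Sum>k<n. monom 1 k)"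
    by (intro poly_eqI) (simp add: D_def coeff_map_poly coeff_sum)
  then have F: "poly F u = (\<Sum>k<n. u ^ k) ^ m" for u
    by (simp add: F_def Fm poly_sum poly_monom)
  have "degree D \<le> n - 1"
    unfolding D_def by (intro degree_sum_le) (auto intro: order.trans[OF degree_monom_le])
  then have "degree (D ^ m) \<le> m * (n - 1)"
    by (metis degree_power_le le_trans mult.commute mult_le_mono2)
  moreover have "degree F = degree (D ^ m)"
    unfolding F_def by (intro degree_map_poly) simp
  ultimately have "poly F u = (\<Sum>k\<le>m * (n - 1). coeff F k * u ^ k)" for u
    unfolding poly_altdef by (intro sum.mono_neutral_left) (auto simp: coeff_eq_0)
  then show ?thesis
    by (intro exI[of _ "coeff (D ^ m)"]) (simp add: F[symmetric], simp add: F_def coeff_map_poly)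
qed


lemma power_one_plus_le:
  fixes t :: real
  assumes "t \<ge> 0"
  shows "(1 + t) ^ (2 * q) \<le> 4 ^ q * (1 + t ^ (2 * q))"
proof -
  have "(1 + t) ^ (2 * q) \<le> (2 * max 1 t) ^ (2 * q)"
    using assms by (intro power_mono) auto
  also have "\<dots> = 4 ^ q * max 1 t ^ (2 * q)"
    by (simp add: power_mult_distrib power_mult)
  also have "max 1 t ^ (2 * q) \<le> 1 + t ^ (2 * q)"
    using assms by (auto simp: max_def)
  finally show ?thesis by simp
qed

lemma sqrt_one_minus_cos: "sqrt (1 - cos \<theta>) = cmod (1 - cis \<theta>) / sqrt 2"
proof -
  have "(cmod (1 - cis \<theta>))\<^sup>2 = 1 - 2 * cos \<theta> + ((cos \<theta>)\<^sup>2 + (sin \<theta>)\<^sup>2)"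
    unfolding cmod_power2 by (simp add: power2_eq_square algebra_simps)
  then have "(cmod (1 - cis \<theta>))\<^sup>2 = 2 * (1 - cos \<theta>)" by simp
  then have "cmod (1 - cis \<theta>) = sqrt 2 * sqrt (1 - cos \<theta>)"
    by (metis norm_ge_zero real_sqrt_abs2 real_sqrt_mult real_sqrt_unique)
  then show ?thesis by simp
qed

text \<open>
  A bound for the moments of order \<open>2 * q\<close> below; that it is the same for all degrees \<open>n\<close> is the
  content of localization at scale \<open>1 / n\<close>.
\<close>

definition localization_bound :: "nat \<Rightarrow> real"
  where "localization_bound q = 4 ^ q * (1 + 4 ^ q * real (q + 1))"

text \<open>
  With \<open>D\<close> the modulus of the Dirichlet-type sum \<open>\<Sum>k<n. z ^ k\<close> and \<open>m = q + 1\<close>, the kernel is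
  \<open>K = D ^ (2 * m)\<close>.  Two uses of Parseval on the grid give everything.  As
  \<open>D * cmod (z - 1) \<le> 2\<close>, multiplying \<open>K\<close> by the weight \<open>cmod (z - 1) ^ (2 * q)\<close> leaves at most a
  constant times \<open>D\<^sup>2\<close>, whose sum over the grid is known.  The sum \<open>Z\<close> of \<open>K\<close> over the grid is
  bounded below by the Cauchy-Schwarz inequality for the coefficients of the \<open>m\<close>-th power.
  
  The weight \<open>\<bar>sqrt (1 - x) - sqrt (1 - y)\<bar>\<close> is available because \<open>sqrt (1 - cos \<theta>)\<close> is a multiple
  of a chord length, so that it is Lipschitz on the circle; it will measure the square root of the
  distance to the boundary.
\<close>

lemma localized_partition_interval:
  assumes "n \<ge> 1"
  shows "\<exists>(N::nat) (c :: nat \<Rightarrow> real poly) y.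
    (\<forall>j<N. degree (c j) \<le> (q + 1) * n) \<and>
    (\<forall>x\<in>{-1..1}. (\<forall>j<N. poly (c j) x \<ge> 0) \<and> (\<Sum>j<N. poly (c j) x) = 1 \<and>
      (\<Sum>j<N. poly (c j) x * (1 + real n * \<bar>x - y j\<bar>) ^ (2 * q)) \<le> localization_bound q \<and>
      (\<Sum>j<N. poly (c j) x * (1 + real n * \<bar>sqrt (1 - x) - sqrt (1 - y j)\<bar>) ^ (2 * q))
        \<le> localization_bound q)"
proof -
  define m N s where "m = q + 1" and "N = m * n" and "s = m * (n - 1)"
  have "s < N"
    unfolding s_def N_def by (rule mult_less_mono2) (use assms in \<open>auto simp: m_def\<close>)
  define \<tau> where "\<tau> = (\<lambda>j. 2 * pi * real j / real N)"
  define D where "D = (\<lambda>\<phi>. cmod (\<Sum>k<n. cis \<phi> ^ k))"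
  define K where "K = (\<lambda>\<phi>. D \<phi> ^ (2 * m))"
  obtain a where a: "\<And>u :: complex. (\<Sum>k<n. u ^ k) ^ m = (\<Sum>k\<le>s. of_real (a k) * u ^ k)"
    using geometric_sum_power_coeffs unfolding s_def by metis
  have K_eq: "K \<phi> = (cmod (\<Sum>k\<le>s. of_real (a k) * cis \<phi> ^ k))\<^sup>2" for \<phi>
    by (simp add: K_def D_def a[symmetric] norm_power power_mult mult.commute[of 2])
  have K_nonneg: "K \<phi> \<ge> 0" and D_nonneg: "D \<phi> \<ge> 0" for \<phi>
    by (simp_all add: K_def D_def)
  define Z where "Z = real N * (\<Sum>k\<le>s. (a k)\<^sup>2)"
  have sum_K: "(\<Sum>j<N. K (\<theta> - \<tau> j)) = Z" for \<theta>
    unfolding K_eq \<tau>_def Z_def by (rule grid_parseval[OF \<open>s < N\<close>])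
  have sum_D: "(\<Sum>j<N. (D (\<theta> - \<tau> j))\<^sup>2) = real N * real n" for \<theta>
  proof -
    have "n - 1 < N" "{..n - 1} = {..<n}"
      using assms by (auto simp: N_def m_def)
    then show ?thesis
      using grid_parseval[of "n - 1" N "\<lambda>_. 1" \<theta>] by (simp add: D_def \<tau>_def)
  qed
  \<comment> \<open>Cauchy-Schwarz loses the factor \<open>s + 1\<close>, which the number \<open>N > s\<close> of grid points restores.\<close>
  have Z_ge: "real n ^ (2 * m) \<le> Z"
  proof -
    have "complex_of_real (\<Sum>k\<le>s. a k) = of_real (real n ^ m)"
      using a[of 1] by simp
    then have "(\<Sum>k\<le>s. a k) = real n ^ m"
      by (simp only: of_real_eq_iff)
    then have "real n ^ (2 * m) = (\<Sum>k\<le>s. a k)\<^sup>2"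
      by (simp add: power_mult[symmetric] mult.commute)
    also have "\<dots> \<le> real (s + 1) * (\<Sum>k\<le>s. (a k)\<^sup>2)"
      using sum_squared_le_sum_of_squares[of a "{..s}"] by (simp add: mult.commute)
    also have "\<dots> \<le> Z"
      unfolding Z_def using \<open>s < N\<close> by (intro mult_right_mono sum_nonneg) auto
    finally show ?thesis .
  qed
  then have "Z > 0"
    using assms by (intro less_le_trans[OF _ Z_ge]) simp
  have moment: "(\<Sum>j<N. K (\<theta> - \<tau> j) * (1 + real n * cmod (cis \<theta> - cis (\<tau> j))) ^ (2 * q))
      \<le> Z * localization_bound q" for \<theta>
  proof -
    have "K (\<theta> - \<tau> j) * (1 + real n * cmod (cis \<theta> - cis (\<tau> j))) ^ (2 * q) \<le>
        4 ^ q * (K (\<theta> - \<tau> j) + real n ^ (2 * q) * 4 ^ q * (D (\<theta> - \<tau> j))\<^sup>2)" for j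
    proof -
      define \<phi> e where "\<phi> = \<theta> - \<tau> j" and "e = cmod (cis \<phi> - 1)"
      have "cis \<theta> - cis (\<tau> j) = cis (\<tau> j) * (cis \<phi> - 1)"
        by (simp add: \<phi>_def algebra_simps cis_mult)
      then have e: "cmod (cis \<theta> - cis (\<tau> j)) = e"
        by (simp add: e_def norm_mult)
      have "D \<phi> * e = cmod (cis \<phi> ^ n - 1)"
        by (simp add: power_diff_1_eq D_def e_def norm_mult)
      also have "\<dots> \<le> 2"
        using norm_triangle_ineq4[of "cis \<phi> ^ n" 1] by (simp add: norm_power)
      finally have "(D \<phi> * e) ^ (2 * q) \<le> 2 ^ (2 * q)"
        by (intro power_mono) (auto simp: e_def D_nonneg)
      then have "(D \<phi> * e) ^ (2 * q) \<le> 4 ^ q"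
        by (simp add: power_mult)
      then have "real n ^ (2 * q) * (D \<phi>)\<^sup>2 * (D \<phi> * e) ^ (2 * q) \<le>
          real n ^ (2 * q) * (D \<phi>)\<^sup>2 * 4 ^ q"
        by (intro mult_left_mono) auto
      moreover have "K \<phi> * (real n * e) ^ (2 * q) =
          real n ^ (2 * q) * (D \<phi>)\<^sup>2 * (D \<phi> * e) ^ (2 * q)"
        by (simp add: K_def m_def power_mult_distrib power_add power2_eq_square)
      moreover have "K \<phi> * (1 + real n * e) ^ (2 * q) \<le> K \<phi> * (4 ^ q * (1 + (real n * e) ^ (2 * q)))"
        by (intro mult_left_mono power_one_plus_le K_nonneg) (simp add: e_def)
      then have "K \<phi> * (1 + real n * e) ^ (2 * q) \<le>
          4 ^ q * (K \<phi> + K \<phi> * (real n * e) ^ (2 * q))"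
        by (simp add: distrib_left mult_ac)
      moreover have "\<dots> \<le> 4 ^ q * (K \<phi> + real n ^ (2 * q) * (D \<phi>)\<^sup>2 * 4 ^ q)"
        using calculation(1,2) by (intro mult_left_mono add_left_mono) auto
      ultimately have "K \<phi> * (1 + real n * e) ^ (2 * q) \<le>
          4 ^ q * (K \<phi> + real n ^ (2 * q) * (D \<phi>)\<^sup>2 * 4 ^ q)"
        by linarith
      then show ?thesis
        by (simp add: e \<phi>_def mult_ac)
    qed
    then have "(\<Sum>j<N. K (\<theta> - \<tau> j) * (1 + real n * cmod (cis \<theta> - cis (\<tau> j))) ^ (2 * q)) \<le>
        (\<Sum>j<N. 4 ^ q * (K (\<theta> - \<tau> j) + real n ^ (2 * q) * 4 ^ q * (D (\<theta> - \<tau> j))\<^sup>2))"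
      by (intro sum_mono)
    also have "\<dots> = 4 ^ q * (Z + real n ^ (2 * q) * 4 ^ q * (real N * real n))"
      by (simp only: sum_distrib_left[symmetric] sum.distrib sum_K sum_D)
    also have "\<dots> = 4 ^ q * (Z + 4 ^ q * real (q + 1) * real n ^ (2 * m))"
      by (simp add: N_def m_def power_add power2_eq_square algebra_simps)
    also have "\<dots> \<le> 4 ^ q * (Z + 4 ^ q * real (q + 1) * Z)"
      using Z_ge by (intro mult_left_mono add_left_mono) auto
    finally show ?thesis
      by (simp add: localization_bound_def algebra_simps)
  qed
  obtain T :: "nat \<Rightarrow> real poly" where
    T: "\<And>k. degree (T k) \<le> k" "\<And>k \<theta>. poly (T k) (cos \<theta>) = cos (real k * \<theta>)"
    using chebyshev_poly_exists by metis
  define p where "p = (\<lambda>k k'. nat \<bar>int k - int k'\<bar>)"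
  have p: "cos (real (p k k') * x) = cos ((real k - real k') * x)" for k k' x
  proof -
    have "real (p k k') = \<bar>real k - real k'\<bar>" by (simp add: p_def)
    then show ?thesis
      by (metis abs_if cos_minus minus_mult_left)
  qed
  \<comment> \<open>The average of \<open>K (\<theta> - \<tau> j)\<close> and \<open>K (- \<theta> - \<tau> j)\<close>, divided by \<open>Z\<close> and written with
    Chebyshev polynomials.\<close>
  define c where "c = (\<lambda>j. smult (1 / Z) (\<Sum>k\<le>s. \<Sum>k'\<le>s.
      smult (a k * a k' * cos (real (p k k') * \<tau> j)) (T (p k k'))))"
  have c: "poly (c j) (cos \<theta>) = (K (\<theta> - \<tau> j) + K (- \<theta> - \<tau> j)) / (2 * Z)" for j \<theta>
  proof -
    have "K (\<theta> - \<tau> j) + K (- \<theta> - \<tau> j) = (\<Sum>k\<le>s. \<Sum>k'\<le>s. a k * a k' *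
        (cos ((real k - real k') * (\<theta> - \<tau> j)) + cos ((real k - real k') * (- \<theta> - \<tau> j))))"
      by (simp only: K_eq norm_trig_poly_squared sum.distrib[symmetric] distrib_left)
    also have "\<dots> = (\<Sum>k\<le>s. \<Sum>k'\<le>s. 2 * (a k * a k' *
        cos ((real k - real k') * \<tau> j) * cos ((real k - real k') * \<theta>)))"
    proof (intro sum.cong refl)
      fix k k'
      define r where "r = real k - real k'"
      have "cos (r * (- \<theta> - \<tau> j)) = cos (r * \<theta> + r * \<tau> j)"
        using cos_minus[of "r * \<theta> + r * \<tau> j"] by (simp add: algebra_simps)
      then show "a k * a k' * (cos (r * (\<theta> - \<tau> j)) + cos (r * (- \<theta> - \<tau> j))) =
          2 * (a k * a k' * cos (r * \<tau> j) * cos (r * \<theta>))"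
        by (simp add: right_diff_distrib cos_add cos_diff algebra_simps)
    qed
    finally show ?thesis
      using \<open>Z > 0\<close> by (simp add: c_def poly_sum T(2) p sum_distrib_left[symmetric])
  qed
  \<comment> \<open>Half of the symmetrized kernel peaks at \<open>- \<tau> j\<close>, so a weight is admissible only if it is
    dominated by the chord for every angle with cosine \<open>x\<close>, that is for both \<open>\<theta>\<close> and \<open>- \<theta>\<close>.\<close>
  have weighted: "(\<Sum>j<N. poly (c j) x * (1 + real n * h j) ^ (2 * q)) \<le> localization_bound q"
    if x: "x \<in> {-1..1}" and h: "\<And>j. h j \<ge> 0"
      "\<And>\<theta> j. cos \<theta> = x \<Longrightarrow> h j \<le> cmod (cis \<theta> - cis (\<tau> j))" for x h
  proof -
    define \<theta> where "\<theta> = arccos x"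
    have th: "cos \<theta> = x" using x by (simp add: \<theta>_def)
    have half: "(\<Sum>j<N. K (\<theta>' - \<tau> j) * (1 + real n * h j) ^ (2 * q)) \<le> Z * localization_bound q"
      if "cos \<theta>' = x" for \<theta>'
      by (rule order.trans[OF sum_mono moment[of \<theta>']],
          intro mult_left_mono power_mono add_left_mono h(2) that) (auto simp: K_nonneg h(1))
    have "(\<Sum>j<N. poly (c j) x * (1 + real n * h j) ^ (2 * q)) =
        ((\<Sum>j<N. K (\<theta> - \<tau> j) * (1 + real n * h j) ^ (2 * q)) +
         (\<Sum>j<N. K (- \<theta> - \<tau> j) * (1 + real n * h j) ^ (2 * q))) / (2 * Z)"
      unfolding th[symmetric] c
      by (simp add: sum.distrib[symmetric] sum_divide_distrib distrib_right)
    also have "\<dots> \<le> (Z * localization_bound q + Z * localization_bound q) / (2 * Z)"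
      using \<open>Z > 0\<close> th by (intro divide_right_mono add_mono half) auto
    finally show ?thesis using \<open>Z > 0\<close> by simp
  qed
  have "degree (c j) \<le> (q + 1) * n" for j
  proof -
    have "degree (T (p k k')) \<le> s" if "k \<le> s" "k' \<le> s" for k k'
      using T(1)[of "p k k'"] that by (auto simp: p_def)
    then have "degree (c j) \<le> s"
      unfolding c_def
      by (intro order.trans[OF degree_smult_le] degree_sum_le) auto
    also have "s \<le> (q + 1) * n"
      using \<open>s < N\<close> by (simp add: N_def m_def)
    finally show ?thesis .
  qed
  moreover have "poly (c j) x \<ge> 0" if "x \<in> {-1..1}" for x j
    using c[of j "arccos x"] that \<open>Z > 0\<close> K_nonneg by simp
  moreover have "(\<Sum>j<N. poly (c j) x) = 1" if "x \<in> {-1..1}" for x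
  proof -
    define \<theta> where "\<theta> = arccos x"
    have "cos \<theta> = x" using that by (simp add: \<theta>_def)
    then have "(\<Sum>j<N. poly (c j) x) = (\<Sum>j<N. (K (\<theta> - \<tau> j) + K (- \<theta> - \<tau> j)) / (2 * Z))"
      using c by auto
    also have "\<dots> = (Z + Z) / (2 * Z)"
      by (simp only: sum_divide_distrib[symmetric] sum.distrib sum_K)
    finally show ?thesis using \<open>Z > 0\<close> by simp
  qed
  moreover have "(\<Sum>j<N. poly (c j) x * (1 + real n * \<bar>x - cos (\<tau> j)\<bar>) ^ (2 * q))
      \<le> localization_bound q" if "x \<in> {-1..1}" for x
  proof (rule weighted[OF that])
    fix \<theta> j
    assume "cos \<theta> = x"
    then show "\<bar>x - cos (\<tau> j)\<bar> \<le> cmod (cis \<theta> - cis (\<tau> j))"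
      using abs_Re_le_cmod[of "cis \<theta> - cis (\<tau> j)"] by simp
  qed simp
  moreover have "(\<Sum>j<N. poly (c j) x *
      (1 + real n * \<bar>sqrt (1 - x) - sqrt (1 - cos (\<tau> j))\<bar>) ^ (2 * q)) \<le> localization_bound q"
    if "x \<in> {-1..1}" for x
  proof (rule weighted[OF that])
    fix \<theta> j
    assume "cos \<theta> = x"
    then have "\<bar>sqrt (1 - x) - sqrt (1 - cos (\<tau> j))\<bar> =
        \<bar>cmod (1 - cis \<theta>) - cmod (1 - cis (\<tau> j))\<bar> / sqrt 2"
      by (auto simp: sqrt_one_minus_cos diff_divide_distrib[symmetric])
    also have "\<dots> \<le> \<bar>cmod (1 - cis \<theta>) - cmod (1 - cis (\<tau> j))\<bar> / 1"
      by (intro divide_left_mono) auto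
    also have "\<dots> \<le> cmod (cis \<theta> - cis (\<tau> j))"
      using norm_triangle_ineq3[of "1 - cis \<theta>" "1 - cis (\<tau> j)"] by (simp add: norm_minus_commute)
    finally show "\<bar>sqrt (1 - x) - sqrt (1 - cos (\<tau> j))\<bar> \<le> cmod (cis \<theta> - cis (\<tau> j))" .
  qed simp
  ultimately show ?thesis
    by (intro exI[of _ N] exI[of _ c] exI[of _ "\<lambda>j. cos (\<tau> j)"]) blast
qed

section \<open>Two-sided balls at the boundary of a twice continuously differentiable domain\<close>

text \<open>
  Taylor's formula along the segment from \<open>x\<close> to \<open>x + v\<close>.  The constant depends on the second
  derivatives alone and holds for all \<open>v\<close>, which later gives a radius that is uniform over the boundary
  even where the gradient is large.
\<close>

lemma class_C2_taylor:
  fixes f :: "real^'d::finite \<Rightarrow> real"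
  assumes "class_C2 f" and M: "\<And>i k y. \<bar>partial_deriv i (partial_deriv k f) y\<bar> \<le> M"
  shows "\<bar>f (x + v) - f x - (\<Sum>k\<in>UNIV. v $ k * partial_deriv k f x)\<bar>
    \<le> (real CARD('d))\<^sup>2 * M * (norm v)\<^sup>2"
proof -
  have M0: "M \<ge> 0"
    using M[of undefined undefined undefined] by linarith
  have diff: "g differentiable (at y) \<Longrightarrow>
      ((\<lambda>s. g (x + s *\<^sub>R v)) has_field_derivative (\<Sum>k\<in>UNIV. v $ k * partial_deriv k g y)) (at s)"
    if "y = x + s *\<^sub>R v" for g :: "real^'d \<Rightarrow> real" and s y
  proof -
    assume g: "g differentiable (at y)"
    define g' where "g' = frechet_derivative g (at y)"
    have g': "(g has_derivative g') (at y)"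
      unfolding g'_def using g by (simp add: frechet_derivative_works)
    then have lin: "linear g'"
      by (simp add: has_derivative_linear)
    have "((\<lambda>s. x + s *\<^sub>R v) has_derivative (\<lambda>h. h *\<^sub>R v)) (at s)"
      by (auto intro!: derivative_eq_intros)
    then have "((\<lambda>s. g (x + s *\<^sub>R v)) has_derivative (\<lambda>h. g' (h *\<^sub>R v))) (at s)"
      using diff_chain_at[of "\<lambda>s. x + s *\<^sub>R v" _ s g g'] g' that by (simp add: o_def)
    moreover have "g' (h *\<^sub>R v) = (\<Sum>k\<in>UNIV. v $ k * partial_deriv k g y) * h" for h
    proof -
      have "v = (\<Sum>k\<in>UNIV. v $ k *\<^sub>R axis k 1)"
        by (simp add: vec_eq_iff sum_component axis_def if_distrib cong: if_cong)
      then have "g' v = g' (\<Sum>k\<in>UNIV. v $ k *\<^sub>R axis k 1)" by simp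
      also have "\<dots> = (\<Sum>k\<in>UNIV. v $ k * g' (axis k 1))"
        by (simp add: linear_sum[OF lin] linear_scale[OF lin])
      finally have "g' v = (\<Sum>k\<in>UNIV. v $ k * g' (axis k 1))" .
      then show ?thesis
        by (simp add: linear_scale[OF lin]) (simp add: partial_deriv_def g'_def)
    qed
    ultimately show ?thesis
      by (simp add: has_field_derivative_def mult_commute_abs)
  qed
  define D1 where "D1 = (\<lambda>s. \<Sum>k\<in>UNIV. v $ k * partial_deriv k f (x + s *\<^sub>R v))"
  define D2 where "D2 = (\<lambda>s. \<Sum>k\<in>UNIV. v $ k *
      (\<Sum>i\<in>UNIV. v $ i * partial_deriv i (partial_deriv k f) (x + s *\<^sub>R v)))"
  define df where "df = (\<lambda>m::nat. if m = 0 then (\<lambda>s. f (x + s *\<^sub>R v)) else if m = 1 then D1 else D2)"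
  have d1: "((\<lambda>s. f (x + s *\<^sub>R v)) has_field_derivative D1 s) (at s)" for s
    unfolding D1_def by (rule diff) (use assms(1) in \<open>auto simp: class_C2_def\<close>)
  have d2: "(D1 has_field_derivative D2 s) (at s)" for s
    unfolding D1_def D2_def
    by (intro DERIV_sum DERIV_cmult diff) (use assms(1) in \<open>auto simp: class_C2_def\<close>)
  have "\<exists>t::real. 0 < t \<and> t < 1 \<and> df 0 1 =
      (\<Sum>m<2. (df m 0 / fact m) * (1 - 0)^m) + (df 2 t / fact 2) * (1 - 0)^2"
    by (rule Taylor_up[of _ _ _ 0]) (use d1 d2 in \<open>auto simp: df_def less_Suc_eq numeral_2_eq_2\<close>)
  then obtain t where t: "f (x + v) = f x + D1 0 + D2 t / 2"
    by (auto simp: df_def numeral_2_eq_2)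
  have "\<bar>v $ k * (\<Sum>i\<in>UNIV. v $ i * partial_deriv i (partial_deriv k f) (x + t *\<^sub>R v))\<bar>
      \<le> norm v * (\<Sum>i\<in>(UNIV :: 'd set). norm v * M)" for k
    unfolding abs_mult
    by (intro mult_mono order.trans[OF sum_abs] sum_mono component_le_norm_cart)
       (auto simp: abs_mult intro!: mult_mono component_le_norm_cart M)
  then have "\<bar>D2 t\<bar> \<le> (\<Sum>k\<in>(UNIV::'d set). norm v * (\<Sum>i\<in>(UNIV :: 'd set). norm v * M))"
    unfolding D2_def by (intro order.trans[OF sum_abs] sum_mono)
  also have "\<dots> = (real CARD('d))\<^sup>2 * M * (norm v)\<^sup>2"
    by (simp add: power2_eq_square)
  finally have "\<bar>D2 t\<bar> \<le> (real CARD('d))\<^sup>2 * M * (norm v)\<^sup>2" .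
  moreover have "D1 0 = (\<Sum>k\<in>UNIV. v $ k * partial_deriv k f x)"
    by (simp add: D1_def)
  ultimately show ?thesis using t by linarith
qed

text \<open>
  The uniform interior and exterior ball condition; \<open>\<nu>\<close> is the outward unit normal at \<open>z\<close>.
\<close>

definition two_sided_ball_condition :: "real \<Rightarrow> 'a::real_normed_vector set \<Rightarrow> bool"
  where "two_sided_ball_condition r S \<longleftrightarrow>
    (\<forall>z\<in>frontier S. \<exists>\<nu>. norm \<nu> = 1 \<and>
       ball (z + r *\<^sub>R \<nu>) r \<inter> S = {} \<and> ball (z - r *\<^sub>R \<nu>) r \<subseteq> S)"

lemma ball_subset_if_infdist_frontier:
  fixes x :: "'a::euclidean_space"
  assumes "x \<in> U"
  shows "ball x (infdist x (frontier U)) \<subseteq> U"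
proof (rule ccontr)
  assume "\<not> ?thesis"
  then obtain p where p: "dist x p < infdist x (frontier U)" "p \<notin> U"
    by (auto simp: subset_eq)
  then have "x \<in> ball x (infdist x (frontier U))"
    by (metis centre_in_ball dist_self le_less_trans zero_le_dist)
  then have "ball x (infdist x (frontier U)) \<inter> frontier U \<noteq> {}"
    using p assms by (intro connected_Int_frontier connected_ball) (fastforce simp: disjoint_iff)+
  then obtain g where "g \<in> frontier U" "dist x g < infdist x (frontier U)" by auto
  then show False
    using infdist_le[of g "frontier U" x] by simp
qed

lemma norm_add_scaled_unit_squared:
  fixes v \<nu> :: "'a::real_inner"
  assumes "norm \<nu> = 1"
  shows "(norm (v + s *\<^sub>R \<nu>))\<^sup>2 = (norm v)\<^sup>2 + 2 * s * (\<nu> \<bullet> v) + s\<^sup>2"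
  using dot_norm[of v "s *\<^sub>R \<nu>"] assms by (simp add: inner_commute power_mult_distrib)

text \<open>
  The quadratic form in which a ball tangent at \<open>z\<close> can be compared with the remainder of Taylor's
  formula.
\<close>

lemma mem_ball_tangent_iff:
  fixes z \<nu> x :: "'a::real_inner"
  assumes "norm \<nu> = 1" "r > 0"
  shows "x \<in> ball (z + r *\<^sub>R \<nu>) r \<longleftrightarrow> (norm (x - z))\<^sup>2 < 2 * r * (\<nu> \<bullet> (x - z))"
proof -
  have "x \<in> ball (z + r *\<^sub>R \<nu>) r \<longleftrightarrow> norm ((x - z) - r *\<^sub>R \<nu>) < r"
    by (simp add: dist_norm norm_minus_commute diff_diff_eq2 algebra_simps)
  also have "\<dots> \<longleftrightarrow> (norm ((x - z) - r *\<^sub>R \<nu>))\<^sup>2 < r\<^sup>2"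
    using assms by (metis norm_ge_zero less_imp_le not_le power_mono_iff zero_less_numeral)
  also have "(norm ((x - z) - r *\<^sub>R \<nu>))\<^sup>2 = (norm (x - z))\<^sup>2 - 2 * r * (\<nu> \<bullet> (x - z)) + r\<^sup>2"
    using norm_add_scaled_unit_squared[OF assms(1), of "x - z" "- r"] by simp
  finally show ?thesis by simp
qed

text \<open>
  In a chart the domain near \<open>z\<close> lies below the graph of \<open>f\<close>, which by Taylor's formula deviates from
  its tangent plane by at most \<open>K * (norm (y - z))\<^sup>2\<close>.  The vector \<open>w\<close> with chart coordinates
  \<open>(- gradient, 1)\<close> is normal to this plane and has norm at least \<open>1\<close>.  Hence normalizing it only
  helps, and no bound for the gradient enters the radius.
\<close>

lemma C2_domain_two_sided_ball_condition:
  fixes D :: "((real^'d::finite) \<times> real) set"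
  assumes "C2_domain D"
  shows "\<exists>r>0. two_sided_ball_condition r D"
proof -
  obtain \<delta> M \<U> where "open D" and "\<delta> > 0" "M > 0" and
    cover: "\<forall>x\<in>D. infdist x (frontier D) < \<delta> \<longrightarrow> (\<exists>U\<in>\<U>. x \<in> U \<and> infdist x (frontier U) > \<delta>)" and
    charts: "\<forall>U\<in>\<U>. open U \<and> graph_chart M D U"
    using assms unfolding C2_domain_def by blast
  define K where "K = (real CARD('d))\<^sup>2 * M"
  have "K > 0" using \<open>M > 0\<close> by (simp add: K_def)
  define r where "r = min (\<delta> / 4) (1 / (2 * K))"
  have r: "r > 0" "2 * r \<le> \<delta> / 2" "K \<le> 1 / (2 * r)"
    using \<open>\<delta> > 0\<close> \<open>K > 0\<close> by (auto simp: r_def min_def field_simps)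
  have "\<exists>\<nu>. norm \<nu> = 1 \<and> ball (z + r *\<^sub>R \<nu>) r \<inter> D = {} \<and> ball (z - r *\<^sub>R \<nu>) r \<subseteq> D"
    if z: "z \<in> frontier D" for z
  proof -
    have "z \<in> closure D" "z \<notin> D"
      using z \<open>open D\<close> by (auto simp: frontier_def interior_open)
    then obtain x where x: "x \<in> D" "dist x z < \<delta> / 2"
      using \<open>\<delta> > 0\<close> by (metis closure_approachable half_gt_zero)
    have "infdist x (frontier D) < \<delta>"
      using infdist_le[OF z, of x] x \<open>\<delta> > 0\<close> by simp
    then obtain U where U: "U \<in> \<U>" "x \<in> U" "infdist x (frontier U) > \<delta>"
      using cover x by blast
    have ball_U: "ball z (\<delta> / 2) \<subseteq> U"
    proof
      fix p assume "p \<in> ball z (\<delta> / 2)"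
      then have "dist x p < \<delta>"
        using x(2) dist_triangle[of x p z] by simp
      then show "p \<in> U"
        using ball_subset_if_infdist_frontier[OF U(2)] U(3) by force
    qed
    obtain L :: "(real^'d) \<times> real \<Rightarrow> (real^'d) \<times> real" and a f where L: "orthogonal_transformation L" and f: "class_C2 f"
        "\<And>i k y. \<bar>partial_deriv i (partial_deriv k f) y\<bar> \<le> M"
      and DU: "D \<inter> U = {x \<in> U. snd (L x + a) < f (fst (L x + a))}"
      using charts U(1) unfolding graph_chart_def by blast
    define x0 where "x0 = fst (L z + a)"
    have "z \<in> U" using ball_U \<open>\<delta> > 0\<close> by auto
    then have "snd (L z + a) = f x0"
    proof (intro antisym)
      have "z \<in> {x \<in> U. snd (L x + a) \<le> f (fst (L x + a))}"
        using closure_in_graph_chart[OF _ L f(1) DU] charts U(1) \<open>z \<in> closure D\<close> \<open>z \<in> U\<close> by blast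
      then show "snd (L z + a) \<le> f x0" by (simp add: x0_def)
      have "z \<notin> {x \<in> U. snd (L x + a) < f (fst (L x + a))}"
        using DU \<open>z \<notin> D\<close> by blast
      then show "f x0 \<le> snd (L z + a)" using \<open>z \<in> U\<close> by (simp add: x0_def)
    qed
    define w' where "w' = (- (\<chi> k. partial_deriv k f x0), 1 :: real)"
    obtain w where w: "L w = w'"
      using orthogonal_transformation_surj[OF L] by (metis surjD)
    have "norm w \<ge> 1"
    proof -
      have "norm w = norm w'"
        using L w by (metis orthogonal_transformation_norm)
      also have "\<dots> \<ge> 1"
        using norm_snd_le[of "1::real" "fst w'"] by (simp add: w'_def)
      finally show ?thesis .
    qed
    define \<nu> where "\<nu> = w /\<^sub>R norm w"
    have "w \<noteq> 0" using \<open>norm w \<ge> 1\<close> by auto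
    then have "norm \<nu> = 1" by (simp add: \<nu>_def)
    \<comment> \<open>The height of the graph above \<open>y\<close> equals \<open>- w \<bullet> (y - z)\<close> up to the Taylor remainder.\<close>
    have graph: "\<bar>f (fst (L y + a)) - snd (L y + a) + w \<bullet> (y - z)\<bar> \<le> K * (norm (y - z))\<^sup>2" for y
    proof -
      define v where "v = L (y - z)"
      have lin: "linear L"
        using L by (simp add: orthogonal_transformation_def)
      have y: "L y + a = (L z + a) + v"
        by (simp add: v_def linear_diff[OF lin])
      have "w \<bullet> (y - z) = w' \<bullet> v"
        unfolding v_def w[symmetric] using L by (metis orthogonal_transformation_def)
      also have "\<dots> = snd v - (\<Sum>k\<in>UNIV. fst v $ k * partial_deriv k f x0)"
        by (simp add: w'_def inner_prod_def inner_vec_def mult.commute sum_negf)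
      finally have "\<bar>f (fst (L y + a)) - snd (L y + a) + w \<bullet> (y - z)\<bar> =
          \<bar>f (x0 + fst v) - f x0 - (\<Sum>k\<in>UNIV. fst v $ k * partial_deriv k f x0)\<bar>"
        using \<open>snd (L z + a) = f x0\<close> by (simp add: y x0_def)
      also have "\<dots> \<le> K * (norm (fst v))\<^sup>2"
        unfolding K_def by (rule class_C2_taylor[OF f])
      also have "\<dots> \<le> K * (norm v)\<^sup>2"
        using \<open>K > 0\<close> by (intro mult_left_mono power_mono norm_fst_le[of "fst v" "snd v", simplified]) auto
      also have "norm v = norm (y - z)"
        using L by (simp add: v_def orthogonal_transformation_norm)
      finally show ?thesis .
    qed
    \<comment> \<open>Both tangent balls stay inside the chart, and there the linear term exceeds the remainder; the sign
      of \<open>\<nu> \<bullet> (y - z)\<close> then decides the side of the graph.\<close>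
    have near: "y \<in> U \<and> K * (norm (y - z))\<^sup>2 < \<bar>w \<bullet> (y - z)\<bar>"
      if y: "(norm (y - z))\<^sup>2 < 2 * r * \<bar>\<nu> \<bullet> (y - z)\<bar>" for y
    proof
      have "\<bar>\<nu> \<bullet> (y - z)\<bar> \<le> norm (y - z)"
        using Cauchy_Schwarz_ineq2[of \<nu> "y - z"] \<open>norm \<nu> = 1\<close> by simp
      then have "(norm (y - z))\<^sup>2 < 2 * r * norm (y - z)"
        using y r(1) by (smt (verit) mult_left_mono)
      then have "norm (y - z) < 2 * r"
        by (simp add: power2_eq_square mult_less_cancel_right)
      then show "y \<in> U"
        using ball_U r(2) by (simp add: subset_eq dist_norm norm_minus_commute)
      have "K * (norm (y - z))\<^sup>2 \<le> 1 / (2 * r) * (norm (y - z))\<^sup>2"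
        by (intro mult_right_mono r) auto
      also have "\<dots> < \<bar>\<nu> \<bullet> (y - z)\<bar>"
        using y r(1) by (simp add: field_simps)
      also have "\<dots> = \<bar>w \<bullet> (y - z)\<bar> / norm w"
        by (simp add: \<nu>_def abs_mult divide_inverse mult.commute)
      also have "\<dots> \<le> \<bar>w \<bullet> (y - z)\<bar> / 1"
        using \<open>norm w \<ge> 1\<close> by (intro divide_left_mono) auto
      finally show "K * (norm (y - z))\<^sup>2 < \<bar>w \<bullet> (y - z)\<bar>" by simp
    qed
    have sign: "w \<bullet> (y - z) = norm w * (\<nu> \<bullet> (y - z))" for y
      using \<open>w \<noteq> 0\<close> by (simp add: \<nu>_def)
    have "y \<notin> D" if y: "y \<in> ball (z + r *\<^sub>R \<nu>) r" for y
    proof -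
      have *: "(norm (y - z))\<^sup>2 < 2 * r * (\<nu> \<bullet> (y - z))"
        using y \<open>norm \<nu> = 1\<close> r(1) by (simp only: mem_ball_tangent_iff)
      then have "2 * r * (\<nu> \<bullet> (y - z)) > 0"
        by (rule le_less_trans[rotated]) simp
      then have pos: "\<nu> \<bullet> (y - z) > 0"
        using r(1) by (simp add: zero_less_mult_iff)
      then have "w \<bullet> (y - z) \<ge> 0"
        unfolding sign by simp
      then have "f (fst (L y + a)) < snd (L y + a)"
        using near[of y] * pos graph[of y] by linarith
      then have "y \<notin> {x \<in> U. snd (L x + a) < f (fst (L x + a))}" by simp
      moreover have "y \<in> U" using near[of y] * pos by linarith
      ultimately show ?thesis
        using DU by blast
    qed
    moreover have "y \<in> D" if y: "y \<in> ball (z - r *\<^sub>R \<nu>) r" for y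
    proof -
      have *: "(norm (y - z))\<^sup>2 < 2 * r * (- \<nu> \<bullet> (y - z))"
        using y \<open>norm \<nu> = 1\<close> r(1) mem_ball_tangent_iff[of "- \<nu>" r y z] by simp
      then have "2 * r * (- \<nu> \<bullet> (y - z)) > 0"
        by (rule le_less_trans[rotated]) simp
      then have neg: "\<nu> \<bullet> (y - z) < 0"
        using r(1) by (simp add: mult_less_0_iff)
      then have "w \<bullet> (y - z) \<le> 0"
        unfolding sign by (simp add: mult_nonneg_nonpos)
      moreover have near_y: "y \<in> U \<and> K * (norm (y - z))\<^sup>2 < \<bar>w \<bullet> (y - z)\<bar>"
        using * neg by (intro near) simp
      ultimately have "snd (L y + a) < f (fst (L y + a))"
        using graph[of y] by linarith
      then have "y \<in> {x \<in> U. snd (L x + a) < f (fst (L x + a))}" using near_y by simp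
      then show ?thesis
        using DU by blast
    qed
    ultimately show ?thesis
      using \<open>norm \<nu> = 1\<close> by (intro exI[of _ \<nu>]) auto
  qed
  then show ?thesis
    using r(1) by (auto simp: two_sided_ball_condition_def)
qed

lemma two_sided_ball_condition_closure:
  assumes "two_sided_ball_condition r S"
  shows "two_sided_ball_condition r (closure S)"
  unfolding two_sided_ball_condition_def
proof
  fix z
  assume "z \<in> frontier (closure S)"
  then have "z \<in> frontier S"
    using interior_mono[OF closure_subset[of S]] by (auto simp: frontier_def)
  then obtain \<nu> where "norm \<nu> = 1" "ball (z + r *\<^sub>R \<nu>) r \<inter> S = {}" "ball (z - r *\<^sub>R \<nu>) r \<subseteq> S"
    using assms unfolding two_sided_ball_condition_def by blast
  then show "\<exists>\<nu>. norm \<nu> = 1 \<and> ball (z + r *\<^sub>R \<nu>) r \<inter> closure S = {} \<and>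
      ball (z - r *\<^sub>R \<nu>) r \<subseteq> closure S"
    using closure_subset[of S]
    by (intro exI[of _ \<nu>]) (auto simp: open_Int_closure_eq_empty)
qed

section \<open>Quadratic models of the distance to the boundary\<close>

lemma infdist_frontier_le_dist:
  fixes x :: "'a::euclidean_space"
  assumes "x \<in> S" "p \<notin> S"
  shows "infdist x (frontier S) \<le> dist x p"
  using ball_subset_if_infdist_frontier[OF assms(1)] assms(2)
  by (metis mem_ball not_le subsetD)

text \<open>
  The segment from \<open>x\<close> to a point of the ball on the way to its centre leaves \<open>S\<close>, hence meets the
  boundary.
\<close>

lemma infdist_frontier_le_exterior_ball:
  fixes x :: "'a::euclidean_space"
  assumes "x \<in> S" "ball c r \<inter> S = {}" "r > 0"
  shows "infdist x (frontier S) \<le> dist x c - r"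
proof (rule field_le_epsilon)
  fix e :: real assume "e > 0"
  define R where "R = dist x c"
  \<comment> \<open>Being less than \<open>r\<close>, this distance from \<open>c\<close> puts \<open>p\<close> into the open ball.\<close>
  define s where "s = max 0 (r - e)"
  have "x \<notin> ball c r" using assms by auto
  then have "R \<ge> r" by (simp add: R_def dist_commute)
  then have "R > 0" using assms by simp
  have s: "0 \<le> s" "s < r" using \<open>e > 0\<close> assms by (auto simp: s_def)
  define p where "p = c + (s / R) *\<^sub>R (x - c)"
  have "dist c p = s"
    using \<open>R > 0\<close> s by (simp add: p_def dist_norm R_def norm_minus_commute)
  then have "p \<notin> S" using assms s by auto
  have "x - p = (1 - s / R) *\<^sub>R (x - c)"
    by (simp add: p_def algebra_simps)
  then have "dist x p = \<bar>1 - s / R\<bar> * R"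
    by (simp add: dist_norm R_def)
  also have "\<dots> = R - s"
    using \<open>R > 0\<close> \<open>R \<ge> r\<close> s by (simp add: field_simps)
  finally have "dist x p = R - s" .
  then show "infdist x (frontier S) \<le> dist x c - r + e"
    using infdist_frontier_le_dist[OF assms(1) \<open>p \<notin> S\<close>] by (simp add: s_def R_def max_def split: if_splits)
qed

lemma infdist_frontier_ge_interior_ball:
  fixes x :: "'a::euclidean_space"
  assumes "ball c r \<subseteq> S" "frontier S \<noteq> {}"
  shows "r - dist x c \<le> infdist x (frontier S)"
  unfolding infdist_notempty[OF assms(2)]
proof (rule cINF_greatest[OF assms(2)])
  fix g assume "g \<in> frontier S"
  have "ball c r \<subseteq> interior S"
    using assms(1) by (simp add: interior_maximal)
  then have "g \<notin> ball c r"
    using \<open>g \<in> frontier S\<close> by (auto simp: frontier_def)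
  then show "r - dist x c \<le> dist x g"
    using dist_triangle[of c g x] by (simp add: dist_commute)
qed

text \<open>
  The Euclidean norm is bounded by its second-order expansion at \<open>R *\<^sub>R \<nu>\<close>, by the inequality of
  the arithmetic and geometric means.
\<close>

lemma norm_add_le_second_order:
  fixes v \<nu> :: "'a::real_inner"
  assumes "norm \<nu> = 1" "R > 0"
  shows "norm (v + R *\<^sub>R \<nu>) \<le> R + \<nu> \<bullet> v + (norm v)\<^sup>2 / (2 * R)"
proof -
  have "(norm (v + R *\<^sub>R \<nu>))\<^sup>2 = (norm v)\<^sup>2 + 2 * R * (\<nu> \<bullet> v) + R\<^sup>2"
    by (rule norm_add_scaled_unit_squared[OF assms(1)])
  moreover have "2 * R * norm (v + R *\<^sub>R \<nu>) \<le> (norm (v + R *\<^sub>R \<nu>))\<^sup>2 + R\<^sup>2"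
    using sum_squares_bound[of "norm (v + R *\<^sub>R \<nu>)" R] by (simp add: mult_ac)
  ultimately have "2 * R * norm (v + R *\<^sub>R \<nu>) \<le>
      2 * R * (R + \<nu> \<bullet> v + (norm v)\<^sup>2 / (2 * R))"
    using assms by (simp add: distrib_left power2_eq_square)
  then show ?thesis
    using assms by (simp only: mult_le_cancel_left_pos mult_pos_pos zero_less_numeral)
qed

text \<open>
  Let \<open>z\<close> be a boundary point nearest to \<open>y\<close> and \<open>\<nu>\<close> the normal there.  The exterior ball forces
  \<open>y = z - \<delta> *\<^sub>R \<nu>\<close>.  The distances to the centres \<open>z \<plusminus> r *\<^sub>R \<nu>\<close> bound the distance to the
  boundary from above and from below, and both bounds expand at \<open>y\<close> as
  \<open>\<delta> - \<nu> \<bullet> (x - y)\<close> up to a multiple of \<open>(norm (x - y))\<^sup>2\<close>.  Adding the error term of the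
  upper bound to this common linear part yields a quadratic polynomial above the distance, which in
  particular is nonnegative on all of \<open>S\<close>.  The condition \<open>\<delta> \<le> r / 2\<close> keeps \<open>y\<close> away from the centre
  of the interior ball, where the expansion degenerates.
\<close>

lemma quadratic_model_of_boundary_distance:
  fixes S :: "'a::euclidean_space set"
  assumes "two_sided_ball_condition r S" "r > 0" "frontier S \<noteq> {}"
    and "y \<in> S" "infdist y (frontier S) \<le> r / 2"
  shows "\<exists>t\<in>poly_space 2. \<forall>x\<in>S. infdist x (frontier S) \<le> t x \<and>
    t x \<le> infdist x (frontier S) + 3 / (2 * r) * (norm (x - y))\<^sup>2"
proof -
  define \<delta> where "\<delta> = infdist y (frontier S)"
  obtain z where z: "z \<in> frontier S" "\<delta> = dist y z"
    unfolding \<delta>_def using infdist_attains_inf[OF frontier_closed assms(3)] by blast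
  obtain \<nu> where \<nu>: "norm \<nu> = 1" and ext: "ball (z + r *\<^sub>R \<nu>) r \<inter> S = {}"
    and int: "ball (z - r *\<^sub>R \<nu>) r \<subseteq> S"
    using assms(1) z(1) unfolding two_sided_ball_condition_def by blast
  have \<delta>: "0 \<le> \<delta>" "\<delta> \<le> r / 2"
    using assms(5) infdist_nonneg by (auto simp: \<delta>_def)
  \<comment> \<open>The balls of radius \<open>\<delta>\<close> about \<open>y\<close> and of radius \<open>r\<close> about \<open>z + r *\<^sub>R \<nu>\<close> do not overlap, yet
    both have \<open>z\<close> on their boundary; so equality holds in the triangle inequality.\<close>
  have "y - z = - \<delta> *\<^sub>R \<nu>"
  proof -
    have "\<delta> + r \<le> norm (y - z - r *\<^sub>R \<nu>)"
      using infdist_frontier_le_exterior_ball[OF assms(4) ext assms(2)]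
      by (simp add: \<delta>_def dist_norm algebra_simps)
    then have "(\<delta> + r)\<^sup>2 \<le> (norm (y - z - r *\<^sub>R \<nu>))\<^sup>2"
      using \<delta> assms(2) by (intro power_mono) auto
    also have "\<dots> = \<delta>\<^sup>2 - 2 * r * (\<nu> \<bullet> (y - z)) + r\<^sup>2"
      using norm_add_scaled_unit_squared[OF \<nu>, of "y - z" "- r"] by (simp add: z(2) dist_norm)
    finally have "r * (\<nu> \<bullet> (y - z)) \<le> r * (- \<delta>)"
      by (simp add: power2_eq_square algebra_simps)
    then have "\<nu> \<bullet> (y - z) \<le> - \<delta>"
      using assms(2) by (simp only: mult_le_cancel_left_pos)
    have "(norm (y - z + \<delta> *\<^sub>R \<nu>))\<^sup>2 = \<delta>\<^sup>2 + 2 * \<delta> * (\<nu> \<bullet> (y - z)) + \<delta>\<^sup>2"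
      using norm_add_scaled_unit_squared[OF \<nu>, of "y - z" \<delta>] by (simp add: z(2) dist_norm)
    also have "\<dots> \<le> \<delta>\<^sup>2 + 2 * \<delta> * (- \<delta>) + \<delta>\<^sup>2"
      using \<open>\<nu> \<bullet> (y - z) \<le> - \<delta>\<close> \<delta>(1) by (intro add_mono mult_left_mono) auto
    finally have "(norm (y - z + \<delta> *\<^sub>R \<nu>))\<^sup>2 \<le> 0"
      by (simp add: power2_eq_square)
    then show ?thesis
      by (simp add: eq_neg_iff_add_eq_0)
  qed
  then have y: "y = z - \<delta> *\<^sub>R \<nu>"
    by (simp add: algebra_simps)
  define t where "t = (\<lambda>x. \<delta> + (- 1) * (\<nu> \<bullet> (x - y)) + 1 / (2 * r) * (norm (x - y))\<^sup>2)"
  have inner_poly: "(\<lambda>x. u \<bullet> (x - y)) \<in> poly_space 1" for u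
  proof -
    have "(\<lambda>x. u \<bullet> x + - (u \<bullet> y)) \<in> poly_space 1"
      by (intro poly_space_add poly_space_inner poly_space_const) simp
    then show ?thesis by (simp add: inner_diff_right)
  qed
  have "(\<lambda>x. (norm (x - y))\<^sup>2) = (\<lambda>x. \<Sum>b\<in>Basis. (b \<bullet> (x - y)) * (b \<bullet> (x - y)))"
    by (simp add: power2_norm_eq_inner euclidean_inner[of "_ - y"] inner_commute)
  also have "\<dots> \<in> poly_space 2"
    by (intro poly_space_sum poly_space_mult[OF inner_poly inner_poly]) simp
  finally have "t \<in> poly_space 2"
    unfolding t_def
    by (intro poly_space_add poly_space_const poly_space_cmult poly_space_mono[OF inner_poly]) auto
  moreover have "infdist x (frontier S) \<le> t x" if "x \<in> S" for x
  proof -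
    have "infdist x (frontier S) \<le> dist x (z + r *\<^sub>R \<nu>) - r"
      by (rule infdist_frontier_le_exterior_ball[OF that ext assms(2)])
    also have "dist x (z + r *\<^sub>R \<nu>) = norm ((x - y) + (r + \<delta>) *\<^sub>R (- \<nu>))"
      by (simp add: dist_norm y algebra_simps)
    also have "\<dots> \<le> (r + \<delta>) + - \<nu> \<bullet> (x - y) + (norm (x - y))\<^sup>2 / (2 * (r + \<delta>))"
      by (rule norm_add_le_second_order) (use \<nu> \<delta> assms(2) in auto)
    also have "(norm (x - y))\<^sup>2 / (2 * (r + \<delta>)) \<le> (norm (x - y))\<^sup>2 / (2 * r)"
      using \<delta> assms(2) by (intro divide_left_mono) auto
    finally show ?thesis by (simp add: t_def)
  qed
  moreover have "t x \<le> infdist x (frontier S) + 3 / (2 * r) * (norm (x - y))\<^sup>2" if "x \<in> S" for x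
  proof -
    have "r - infdist x (frontier S) \<le> dist x (z - r *\<^sub>R \<nu>)"
      using infdist_frontier_ge_interior_ball[OF int assms(3), of x] by simp
    also have "dist x (z - r *\<^sub>R \<nu>) = norm ((x - y) + (r - \<delta>) *\<^sub>R \<nu>)"
      by (simp add: dist_norm y algebra_simps)
    also have "\<dots> \<le> (r - \<delta>) + \<nu> \<bullet> (x - y) + (norm (x - y))\<^sup>2 / (2 * (r - \<delta>))"
      by (rule norm_add_le_second_order) (use \<nu> \<delta> assms(2) in auto)
    also have "(norm (x - y))\<^sup>2 / (2 * (r - \<delta>)) \<le> (norm (x - y))\<^sup>2 / r"
      using \<delta> assms(2) by (intro divide_left_mono) auto
    finally have "\<delta> - \<nu> \<bullet> (x - y) \<le> infdist x (frontier S) + (norm (x - y))\<^sup>2 / r" by simp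
    moreover have "3 / (2 * r) * (norm (x - y))\<^sup>2 = (norm (x - y))\<^sup>2 / r + 1 / (2 * r) * (norm (x - y))\<^sup>2"
      using assms(2) by (simp add: field_simps)
    ultimately show ?thesis by (simp add: t_def)
  qed
  ultimately show ?thesis by blast
qed

lemma sqrt_diff_le_sqrt:
  fixes a b :: real
  assumes "0 \<le> a" "a \<le> b"
  shows "sqrt b - sqrt a \<le> sqrt (b - a)"
  using sqrt_add_le_add_sqrt[of a "b - a"] assms by simp

text \<open>
  Near the boundary the quadratic model has error \<open>O((norm (x - y))\<^sup>2)\<close>, and the square root turns
  it into \<open>O(norm (x - y))\<close>.  Away from the boundary the constant \<open>infdist y (frontier S)\<close> serves,
  since there the square root is Lipschitz.  For \<open>y\<close> outside \<open>S\<close> the model at the nearest point of \<open>S\<close>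
  is used, at the price of a factor \<open>2\<close>.
  
  The bounds \<open>0\<close> and \<open>T\<close> let the polynomial be rescaled to values in \<open>{-1..1}\<close>; \<open>T \<ge> 2\<close> keeps the
  rescaling factor \<open>sqrt (T / 2)\<close> at least \<open>1\<close>.
\<close>

lemma sqrt_dist_quadratic_models:
  fixes S :: "'a::euclidean_space set"
  assumes "two_sided_ball_condition r S" "r > 0" "compact S" "S \<noteq> {}"
  shows "\<exists>C T. C \<ge> 0 \<and> T \<ge> 2 \<and> (\<forall>y. \<exists>t\<in>poly_space 2. \<forall>x\<in>S. 0 \<le> t x \<and> t x \<le> T \<and>
    \<bar>sqrt (t x) - sqrt (infdist x (frontier S))\<bar> \<le> C * norm (x - y))"
proof -
  let ?d = "\<lambda>x. infdist x (frontier S)"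
  have "S \<noteq> UNIV" using assms(3) not_compact_UNIV by blast
  then have ne: "frontier S \<noteq> {}" using assms(4) frontier_not_empty by blast
  then obtain z where z: "z \<in> frontier S" by blast
  have "z \<in> S" using z assms(3) by (simp add: compact_imp_closed frontier_def)
  define B where "B = diameter S"
  have B: "dist x y \<le> B" if "x \<in> S" "y \<in> S" for x y
    unfolding B_def using that assms(3) by (intro diameter_bounded_bound compact_imp_bounded)
  have dB: "?d x \<le> B" if "x \<in> S" for x
    using infdist_le[OF z, of x] B[OF that \<open>z \<in> S\<close>] by simp
  define C where "C = sqrt (2 / r)"
  define T where "T = 2 + B + 3 / (2 * r) * B\<^sup>2"
  have "B \<ge> 0" using B[OF \<open>z \<in> S\<close> \<open>z \<in> S\<close>] by simp
  then have T: "T \<ge> 2" "B \<le> T" "B + 3 / (2 * r) * B\<^sup>2 \<le> T"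
    using assms(2) by (auto simp: T_def)
  have "C \<ge> 0" using assms(2) by (simp add: C_def)
  have inside: "\<exists>t\<in>poly_space 2. \<forall>x\<in>S. 0 \<le> t x \<and> t x \<le> T \<and>
      \<bar>sqrt (t x) - sqrt (?d x)\<bar> \<le> C * norm (x - y)" if y: "y \<in> S" for y
  proof (cases "?d y \<le> r / 2")
    case True
    obtain t where t: "t \<in> poly_space 2"
      "\<And>x. x \<in> S \<Longrightarrow> ?d x \<le> t x" "\<And>x. x \<in> S \<Longrightarrow> t x \<le> ?d x + 3 / (2 * r) * (norm (x - y))\<^sup>2"
      using quadratic_model_of_boundary_distance[OF assms(1,2) ne y True] by blast
    have "t x \<le> T" if "x \<in> S" for x
    proof -
      have "t x \<le> ?d x + 3 / (2 * r) * (norm (x - y))\<^sup>2" by (rule t(3)[OF that])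
      also have "\<dots> \<le> B + 3 / (2 * r) * B\<^sup>2"
        using dB[OF that] B[OF that y] assms(2)
        by (intro add_mono mult_left_mono power_mono) (auto simp: dist_norm)
      finally show ?thesis using T by simp
    qed
    moreover have "\<bar>sqrt (t x) - sqrt (?d x)\<bar> \<le> C * norm (x - y)" if "x \<in> S" for x
    proof -
      have "\<bar>sqrt (t x) - sqrt (?d x)\<bar> = sqrt (t x) - sqrt (?d x)"
        using t(2)[OF that] by simp
      also have "\<dots> \<le> sqrt (t x - ?d x)"
        using t(2)[OF that] by (intro sqrt_diff_le_sqrt infdist_nonneg)
      also have "\<dots> \<le> sqrt (2 / r * (norm (x - y))\<^sup>2)"
      proof (rule real_sqrt_le_mono)
        have "3 / (2 * r) * (norm (x - y))\<^sup>2 \<le> 2 / r * (norm (x - y))\<^sup>2"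
          using assms(2) by (intro mult_right_mono) (auto simp: field_simps)
        then show "t x - ?d x \<le> 2 / r * (norm (x - y))\<^sup>2"
          using t(3)[OF that] by simp
      qed
      also have "\<dots> = C * norm (x - y)"
        unfolding C_def by (subst real_sqrt_mult) simp
      finally show ?thesis .
    qed
    moreover have "0 \<le> t x" if "x \<in> S" for x
      using t(2)[OF that] infdist_nonneg[of x "frontier S"] by linarith
    ultimately show ?thesis using t(1) by blast
  next
    case False
    have "\<bar>sqrt (?d y) - sqrt (?d x)\<bar> \<le> C * norm (x - y)" if "x \<in> S" for x
    proof -
      define a b where "a = sqrt (?d y)" and "b = sqrt (?d x)"
      have ab: "a\<^sup>2 = ?d y" "b\<^sup>2 = ?d x" "b \<ge> 0"
        by (simp_all add: a_def b_def infdist_nonneg)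
      have a: "a \<ge> sqrt (r / 2)"
        using False by (simp add: a_def)
      have "sqrt (r / 2) * \<bar>a - b\<bar> \<le> (a + b) * \<bar>a - b\<bar>"
        using a ab by (intro mult_right_mono) auto
      also have "\<dots> = \<bar>a\<^sup>2 - b\<^sup>2\<bar>"
      proof -
        have "a \<ge> 0" by (simp add: a_def infdist_nonneg)
        then show ?thesis
          using ab(3) by (simp add: power2_eq_square square_diff_square_factored abs_mult)
      qed
      also have "\<dots> \<le> norm (x - y)"
        using infdist_triangle_abs[of y "frontier S" x] by (simp add: ab dist_norm norm_minus_commute)
      finally have "\<bar>a - b\<bar> \<le> norm (x - y) / sqrt (r / 2)"
        using assms(2) by (simp add: pos_le_divide_eq mult.commute)
      moreover have "C = 1 / sqrt (r / 2)"
        by (simp add: C_def real_sqrt_divide)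
      ultimately show ?thesis
        by (simp add: a_def b_def)
    qed
    moreover have "?d y \<le> T" using dB[OF y] T by simp
    ultimately show ?thesis
      by (intro bexI[OF _ poly_space_const[of "?d y"]]) (auto simp: infdist_nonneg)
  qed
  have "\<exists>t\<in>poly_space 2. \<forall>x\<in>S. 0 \<le> t x \<and> t x \<le> T \<and>
      \<bar>sqrt (t x) - sqrt (?d x)\<bar> \<le> (2 * C) * norm (x - y)" for y
  proof -
    obtain y' where y': "y' \<in> S" "infdist y S = dist y y'"
      using infdist_attains_inf[OF compact_imp_closed[OF assms(3)] assms(4)] by blast
    obtain t where t: "t \<in> poly_space 2" "\<And>x. x \<in> S \<Longrightarrow> 0 \<le> t x \<and> t x \<le> T \<and>
        \<bar>sqrt (t x) - sqrt (?d x)\<bar> \<le> C * norm (x - y')"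
      using inside[OF y'(1)] by blast
    have "C * norm (x - y') \<le> (2 * C) * norm (x - y)" if "x \<in> S" for x
    proof -
      have "norm (x - y') \<le> norm (x - y) + dist y y'"
        using norm_triangle_ineq[of "x - y" "y - y'"] by (simp add: dist_norm)
      also have "dist y y' \<le> norm (x - y)"
        using infdist_le[OF that, of y] y'(2) by (simp add: dist_norm norm_minus_commute)
      finally show ?thesis
        using \<open>C \<ge> 0\<close> mult_left_mono[of "norm (x - y')" "2 * norm (x - y)" C] by simp
    qed
    then show ?thesis
      using t(2) by (intro bexI[OF _ t(1)] ballI) (metis order.trans)
  qed
  then show ?thesis
    using \<open>C \<ge> 0\<close> T(1) by (intro exI[of _ "2 * C"] exI[of _ T]) auto
qed

section \<open>Products of partitions, grouped around separated centres\<close>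

lemma maximal_separated_subset:
  assumes "finite Z" "\<And>x. \<rho> x x = 0" "\<And>x y. \<rho> x y = \<rho> y x" "\<epsilon> > 0"
  shows "\<exists>\<Lambda>\<subseteq>Z. separated_set \<rho> \<epsilon> \<Lambda> \<and> (\<forall>z\<in>Z. \<exists>s\<in>\<Lambda>. \<rho> z s < \<epsilon>)"
proof -
  define F where "F = {\<Lambda>. \<Lambda> \<subseteq> Z \<and> separated_set \<rho> \<epsilon> \<Lambda>}"
  have "finite F" "{} \<in> F"
    using assms(1) by (auto simp: F_def separated_set_def)
  then obtain \<Lambda> where \<Lambda>: "\<Lambda> \<in> F" "\<And>\<Lambda>'. \<Lambda>' \<in> F \<Longrightarrow> \<Lambda> \<subseteq> \<Lambda>' \<Longrightarrow> \<Lambda> = \<Lambda>'"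
    using finite_has_maximal[of F] by blast
  have "\<exists>s\<in>\<Lambda>. \<rho> z s < \<epsilon>" if "z \<in> Z" for z
  proof (rule ccontr)
    assume *: "\<not> ?thesis"
    then have "insert z \<Lambda> \<in> F"
      using \<Lambda>(1) that assms(3) by (auto simp: F_def separated_set_def not_less)
    then have "z \<in> \<Lambda>"
      using \<Lambda>(2) by blast
    then show False
      using * assms(2,4) by auto
  qed
  then show ?thesis
    using \<Lambda>(1) unfolding F_def by blast
qed

text \<open>
  Replacing a centre by a selected one at distance less than \<open>1 / n\<close> at most doubles the weight
  \<open>1 + n * \<rho>\<close>.  For nonnegative summands the weighted bound for the whole family passes to every group,
  whatever its size.
\<close>

lemma regroup_partition_by_separated_centres:
  fixes \<rho> :: "'a::euclidean_space \<Rightarrow> 'a \<Rightarrow> real" and Q :: "'i \<Rightarrow> 'a \<Rightarrow> real"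
  assumes \<rho>: "\<And>x. \<rho> x x = 0" "\<And>x y. \<rho> x y = \<rho> y x" "\<And>x y z. \<rho> x z \<le> \<rho> x y + \<rho> y z"
      "\<And>x y. \<rho> x y \<ge> 0"
    and "finite I" "n \<ge> 1"
    and Q: "\<And>i. i \<in> I \<Longrightarrow> Q i \<in> poly_space s" "\<And>i x. i \<in> I \<Longrightarrow> x \<in> S \<Longrightarrow> Q i x \<ge> 0"
      "\<And>x. x \<in> S \<Longrightarrow> (\<Sum>i\<in>I. Q i x) = 1"
    and \<zeta>: "\<And>i. i \<in> I \<Longrightarrow> \<zeta> i \<in> S"
    and moment: "\<And>x. x \<in> S \<Longrightarrow> (\<Sum>i\<in>I. Q i x * (1 + real n * \<rho> x (\<zeta> i)) ^ k) \<le> A"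
  shows "\<exists>(m::nat) \<xi> P. inj_on \<xi> {1..m} \<and> \<xi> ` {1..m} \<subseteq> S \<and>
    separated_set \<rho> (1 / real n) (\<xi> ` {1..m}) \<and> (\<forall>j\<in>{1..m}. P j \<in> poly_space s) \<and>
    (\<forall>x\<in>S. (\<Sum>j=1..m. P j x) = 1 \<and>
      (\<forall>j\<in>{1..m}. \<bar>P j x\<bar> * (1 + real n * \<rho> x (\<xi> j)) ^ k \<le> 2 ^ k * A))"
proof -
  have n: "real n > 0" using \<open>n \<ge> 1\<close> by simp
  have "\<exists>\<Lambda>\<subseteq>\<zeta> ` I. separated_set \<rho> (1 / real n) \<Lambda> \<and> (\<forall>z\<in>\<zeta> ` I. \<exists>s\<in>\<Lambda>. \<rho> z s < 1 / real n)"
    using n \<rho> \<open>finite I\<close> by (intro maximal_separated_subset) auto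
  then obtain \<Lambda> where \<Lambda>: "\<Lambda> \<subseteq> \<zeta> ` I" "separated_set \<rho> (1 / real n) \<Lambda>"
      "\<forall>i\<in>I. \<exists>s\<in>\<Lambda>. \<rho> (\<zeta> i) s < 1 / real n" by blast
  then obtain near where near: "\<And>i. i \<in> I \<Longrightarrow> near i \<in> \<Lambda>"
      "\<And>i. i \<in> I \<Longrightarrow> \<rho> (\<zeta> i) (near i) < 1 / real n" by metis
  have "finite \<Lambda>" using \<Lambda>(1) \<open>finite I\<close> by (meson finite_imageI finite_subset)
  then obtain \<xi> where \<xi>: "bij_betw \<xi> {1..card \<Lambda>} \<Lambda>"
    using ex_bij_betw_nat_finite_1 by blast
  define P where "P = (\<lambda>j x. \<Sum>i\<in>{i\<in>I. near i = \<xi> j}. Q i x)"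
  have "(\<Sum>j=1..card \<Lambda>. P j x) = 1" if "x \<in> S" for x
  proof -
    have "(\<Sum>j=1..card \<Lambda>. P j x) = (\<Sum>s\<in>\<Lambda>. \<Sum>i\<in>{i\<in>I. near i = s}. Q i x)"
      unfolding P_def by (rule sum.reindex_bij_betw[OF \<xi>])
    also have "\<dots> = (\<Sum>i\<in>I. Q i x)"
      using near \<open>finite I\<close> \<open>finite \<Lambda>\<close> by (intro sum.group) auto
    finally show ?thesis using Q(3)[OF that] by simp
  qed
  moreover have "\<bar>P j x\<bar> * (1 + real n * \<rho> x (\<xi> j)) ^ k \<le> 2 ^ k * A" if x: "x \<in> S" for j x
  proof -
    have "\<bar>P j x\<bar> = P j x"
      unfolding P_def using Q(2) x by (intro abs_of_nonneg sum_nonneg) auto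
    then have "\<bar>P j x\<bar> * (1 + real n * \<rho> x (\<xi> j)) ^ k =
        (\<Sum>i\<in>{i\<in>I. near i = \<xi> j}. Q i x * (1 + real n * \<rho> x (\<xi> j)) ^ k)"
      by (simp add: P_def sum_distrib_right)
    also have "\<dots> \<le> (\<Sum>i\<in>{i\<in>I. near i = \<xi> j}. 2 ^ k * (Q i x * (1 + real n * \<rho> x (\<zeta> i)) ^ k))"
    proof (intro sum_mono)
      fix i assume i: "i \<in> {i\<in>I. near i = \<xi> j}"
      have "\<rho> x (\<xi> j) \<le> \<rho> x (\<zeta> i) + 1 / real n"
        using \<rho>(3)[of x "\<xi> j" "\<zeta> i"] near(2)[of i] i by auto
      then have "real n * \<rho> x (\<xi> j) \<le> real n * (\<rho> x (\<zeta> i) + 1 / real n)"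
        using n by (intro mult_left_mono) auto
      also have "\<dots> = real n * \<rho> x (\<zeta> i) + 1"
        using n by (simp add: distrib_left)
      finally have "1 + real n * \<rho> x (\<xi> j) \<le> 2 * (1 + real n * \<rho> x (\<zeta> i))"
        using mult_nonneg_nonneg[OF less_imp_le[OF n] \<rho>(4)[of x "\<zeta> i"]] by simp
      then have "(1 + real n * \<rho> x (\<xi> j)) ^ k \<le> (2 * (1 + real n * \<rho> x (\<zeta> i))) ^ k"
        using \<rho>(4)[of x "\<xi> j"] by (intro power_mono) auto
      then have "Q i x * (1 + real n * \<rho> x (\<xi> j)) ^ k \<le>
          Q i x * (2 * (1 + real n * \<rho> x (\<zeta> i))) ^ k"
        using Q(2)[of i x] i x by (intro mult_left_mono) auto
      then show "Q i x * (1 + real n * \<rho> x (\<xi> j)) ^ k \<le> 2 ^ k * (Q i x * (1 + real n * \<rho> x (\<zeta> i)) ^ k)"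
        by (simp only: power_mult_distrib mult.left_commute)
    qed
    also have "\<dots> \<le> (\<Sum>i\<in>I. 2 ^ k * (Q i x * (1 + real n * \<rho> x (\<zeta> i)) ^ k))"
      using \<open>finite I\<close> Q(2) x \<rho>(4) by (intro sum_mono2) auto
    also have "\<dots> \<le> 2 ^ k * A"
      unfolding sum_distrib_left[symmetric] by (intro mult_left_mono moment x) simp
    finally show ?thesis .
  qed
  moreover have "P j \<in> poly_space s" for j
    unfolding P_def by (intro poly_space_sum Q(1)) auto
  moreover have "inj_on \<xi> {1..card \<Lambda>}" "\<xi> ` {1..card \<Lambda>} = \<Lambda>"
    using \<xi> by (auto simp: bij_betw_def)
  moreover have "\<Lambda> \<subseteq> S" using \<Lambda>(1) \<zeta> by auto
  ultimately show ?thesis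
    using \<Lambda>(2) by (intro exI[of _ "card \<Lambda>"] exI[of _ \<xi>] exI[of _ P]) auto
qed

lemma one_plus_sum_le_prod:
  fixes f :: "'i \<Rightarrow> real"
  assumes "\<And>i. i \<in> I \<Longrightarrow> f i \<ge> 0"
  shows "1 + (\<Sum>i\<in>I. f i) \<le> (\<Prod>i\<in>I. 1 + f i)"
  using assms
proof (induction I rule: infinite_finite_induct)
  case (insert i I)
  have "1 + (f i + sum f I) \<le> (1 + f i) * (1 + sum f I)"
    using insert.prems by (simp add: algebra_simps sum_nonneg)
  also have "\<dots> \<le> (1 + f i) * (\<Prod>i\<in>I. 1 + f i)"
    using insert by (intro mult_left_mono) auto
  finally show ?case using insert by simp
qed auto

lemma rho_self: "rho S x x = 0"
  and rho_commute: "rho S x y = rho S y x"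
  and rho_triangle: "rho S x z \<le> rho S x y + rho S y z"
  and rho_nonneg: "rho S x y \<ge> 0"
  using norm_triangle_ineq[of "x - y" "y - z"] by (auto simp: rho_def norm_minus_commute)

text \<open>
  The product \<open>Q (k, i)\<close> is localized where both \<open>norm (x - \<eta> k)\<close> and
  \<open>\<bar>sqrt (t k x) - sqrt (\<tau> i)\<bar>\<close> are at most about \<open>1 / n\<close>, where \<open>\<tau> i\<close> is the node of the
  one-dimensional partition moved to \<open>{0..T}\<close>.  By the assumption on \<open>t\<close> these quantities control
  \<open>\<Phi> k i x = norm (x - \<eta> k) + \<bar>sqrt (d x) - sqrt (\<tau> i)\<bar>\<close>.  The triangle inequality bounds
  \<open>rho S x \<zeta>\<close> by \<open>\<Phi> k i x + \<Phi> k i \<zeta>\<close>, so a minimizer \<open>\<zeta>\<close> of \<open>\<Phi> k i\<close> over \<open>S\<close> is a centre for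
  \<open>Q (k, i)\<close>, even when \<open>\<eta> k\<close> is outside \<open>S\<close> or no point of \<open>S\<close> matches both values.  As weights
  multiply, the moments of the product reduce to those in one dimension.
\<close>

lemma localized_partition_from_quadratic_models:
  fixes S :: "'a::euclidean_space set"
  assumes S: "compact S" "S \<noteq> {}" and CT: "C \<ge> 0" "T \<ge> 2"
    and models: "\<And>y. \<exists>t\<in>poly_space 2. \<forall>x\<in>S. 0 \<le> t x \<and> t x \<le> T \<and>
      \<bar>sqrt (t x) - sqrt (infdist x (frontier S))\<bar> \<le> C * norm (x - y)"
  shows "\<exists>C1. \<forall>n\<ge>1. \<exists>(m::nat) \<xi> P. inj_on \<xi> {1..m} \<and> \<xi> ` {1..m} \<subseteq> S \<and>
    separated_set (rho S) (1 / real n) (\<xi> ` {1..m}) \<and>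
    (\<forall>j\<in>{1..m}. P j \<in> poly_space ((DIM('a) + 2) * ((q + 1) * n))) \<and>
    (\<forall>x\<in>S. (\<Sum>j=1..m. P j x) = 1 \<and>
      (\<forall>j\<in>{1..m}. \<bar>P j x\<bar> * (1 + real n * rho S x (\<xi> j)) ^ (2 * q) \<le> C1))"
proof -
  let ?d = "\<lambda>x. infdist x (frontier S)"
  obtain t where t: "\<And>y. t y \<in> poly_space 2" "\<And>y x. x \<in> S \<Longrightarrow> 0 \<le> t y x"
    "\<And>y x. x \<in> S \<Longrightarrow> t y x \<le> T" "\<And>y x. x \<in> S \<Longrightarrow> \<bar>sqrt (t y x) - sqrt (?d x)\<bar> \<le> C * norm (x - y)"
    using models by metis
  obtain R where R: "R \<ge> 1" "\<And>x. x \<in> S \<Longrightarrow> norm x \<le> R"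
  proof -
    obtain R0 where "\<And>x. x \<in> S \<Longrightarrow> norm x \<le> R0"
      using compact_imp_bounded[OF S(1)] unfolding bounded_iff by blast
    then show ?thesis by (intro that[of "max 1 R0"]) (auto intro: max.coboundedI2)
  qed
  \<comment> \<open>The factors come from the minimizing centre, from the error of \<open>t\<close>, and from rescaling the
    coordinates and \<open>t\<close> to \<open>{-1..1}\<close>.\<close>
  define G where "G = 2 * (1 + C) * R ^ DIM('a) * sqrt (T / 2)"
  have "G \<ge> 0" using CT R(1) by (simp add: G_def)
  define A where "A = G ^ (2 * q) * (localization_bound q ^ DIM('a) * localization_bound q)"
  have "\<exists>(m::nat) \<xi> P. inj_on \<xi> {1..m} \<and> \<xi> ` {1..m} \<subseteq> S \<and>
    separated_set (rho S) (1 / real n) (\<xi> ` {1..m}) \<and>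
    (\<forall>j\<in>{1..m}. P j \<in> poly_space ((DIM('a) + 2) * ((q + 1) * n))) \<and>
    (\<forall>x\<in>S. (\<Sum>j=1..m. P j x) = 1 \<and>
      (\<forall>j\<in>{1..m}. \<bar>P j x\<bar> * (1 + real n * rho S x (\<xi> j)) ^ (2 * q) \<le> 2 ^ (2 * q) * A))"
    if n: "n \<ge> 1" for n
  proof -
    obtain N :: nat and c :: "nat \<Rightarrow> real poly" and u where
      deg: "\<forall>j<N. degree (c j) \<le> (q + 1) * n" and
      part: "\<forall>x\<in>{-1..1}. (\<forall>j<N. poly (c j) x \<ge> 0) \<and> (\<Sum>j<N. poly (c j) x) = 1 \<and>
        (\<Sum>j<N. poly (c j) x * (1 + real n * \<bar>x - u j\<bar>) ^ (2 * q)) \<le> localization_bound q \<and>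
        (\<Sum>j<N. poly (c j) x * (1 + real n * \<bar>sqrt (1 - x) - sqrt (1 - u j)\<bar>) ^ (2 * q))
          \<le> localization_bound q"
      using localized_partition_interval[OF n, of q] by (elim exE conjE) (rule that)
    have c: "\<And>j. j < N \<Longrightarrow> degree (c j) \<le> (q + 1) * n" and
      c_nonneg: "\<And>x j. x \<in> {-1..1} \<Longrightarrow> j < N \<Longrightarrow> poly (c j) x \<ge> 0" and
      c_sum: "\<And>x. x \<in> {-1..1} \<Longrightarrow> (\<Sum>j<N. poly (c j) x) = 1" and
      c_inner: "\<And>x. x \<in> {-1..1} \<Longrightarrow>
        (\<Sum>j<N. poly (c j) x * (1 + real n * \<bar>x - u j\<bar>) ^ (2 * q)) \<le> localization_bound q" and
      c_end: "\<And>x. x \<in> {-1..1} \<Longrightarrow>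
        (\<Sum>j<N. poly (c j) x * (1 + real n * \<bar>sqrt (1 - x) - sqrt (1 - u j)\<bar>) ^ (2 * q))
          \<le> localization_bound q"
      using deg part by blast+
    define K where "K = (Basis :: 'a set) \<rightarrow>\<^sub>E {..<N}"
    have "finite K" by (simp add: K_def finite_PiE)
    have K: "k b < N" if "k \<in> K" "b \<in> Basis" for k b
      using that by (auto simp: K_def)
    define \<eta> where "\<eta> = (\<lambda>k. \<Sum>b\<in>(Basis :: 'a set). (R * u (k b)) *\<^sub>R b)"
    have \<eta>: "\<eta> k \<bullet> b = R * u (k b)" if "b \<in> Basis" for k b
      using that by (simp add: \<eta>_def inner_sum_left_Basis)
    define \<tau> where "\<tau> = (\<lambda>i. T / 2 * (1 - u i))"
    define X where "X = (\<lambda>k x. 1 - 2 / T * t (\<eta> k) x)"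
    define E where "E = (\<lambda>k x. \<Prod>b\<in>(Basis :: 'a set). poly (c (k b)) (x \<bullet> b / R))"
    define Q where "Q = (\<lambda>ki x. E (fst ki) x * poly (c (snd ki)) (X (fst ki) x))"
    define \<Phi> where "\<Phi> = (\<lambda>k i x. norm (x - \<eta> k) + \<bar>sqrt (?d x) - sqrt (\<tau> i)\<bar>)"
    have "\<exists>\<zeta>\<in>S. \<forall>x\<in>S. \<Phi> k i \<zeta> \<le> \<Phi> k i x" for k i
      unfolding \<Phi>_def by (intro continuous_attains_inf S continuous_intros)
    then obtain \<zeta> where \<zeta>: "\<And>k i. \<zeta> k i \<in> S" "\<And>k i x. x \<in> S \<Longrightarrow> \<Phi> k i (\<zeta> k i) \<le> \<Phi> k i x"
      by metis
    have x_R: "x \<bullet> b / R \<in> {-1..1}" if "x \<in> S" "b \<in> Basis" for x b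
      using R(2)[OF that(1)] Basis_le_norm[OF that(2), of x] R(1) by (auto simp: field_simps)
    have X: "X k x \<in> {-1..1}" if "x \<in> S" for k x
      using t(2,3)[OF that, of "\<eta> k"] CT(2) by (auto simp: X_def field_simps)
    have E_nonneg: "E k x \<ge> 0" if "x \<in> S" "k \<in> K" for k x
      unfolding E_def using c_nonneg x_R that K by (intro prod_nonneg) auto
    have localization: "(1 + real n * rho S x (\<zeta> k i)) ^ (2 * q) \<le> G ^ (2 * q) *
        ((\<Prod>b\<in>(Basis :: 'a set). (1 + real n * \<bar>x \<bullet> b / R - u (k b)\<bar>) ^ (2 * q)) *
         (1 + real n * \<bar>sqrt (1 - X k x) - sqrt (1 - u i)\<bar>) ^ (2 * q))"
      if x: "x \<in> S" for x k i
    proof -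
      define p where "p = (\<Prod>b\<in>Basis. 1 + real n * \<bar>x \<bullet> b / R - u (k b)\<bar>)"
      define e where "e = \<bar>sqrt (1 - X k x) - sqrt (1 - u i)\<bar>"
      have "p \<ge> 1"
        unfolding p_def by (intro prod_ge_1) simp
      have space: "1 + real n * norm (x - \<eta> k) \<le> R ^ DIM('a) * p"
      proof -
        have "1 + real n * norm (x - \<eta> k) \<le> 1 + real n * (\<Sum>b\<in>Basis. \<bar>(x - \<eta> k) \<bullet> b\<bar>)"
          by (intro add_left_mono mult_left_mono norm_le_l1) simp
        also have "\<dots> \<le> (\<Prod>b\<in>Basis. 1 + real n * \<bar>(x - \<eta> k) \<bullet> b\<bar>)"
          unfolding sum_distrib_left by (intro one_plus_sum_le_prod) simp
        also have "\<dots> \<le> (\<Prod>b\<in>Basis. R * (1 + real n * \<bar>x \<bullet> b / R - u (k b)\<bar>))"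
        proof (intro prod_mono conjI)
          fix b :: 'a assume b: "b \<in> Basis"
          have "(x - \<eta> k) \<bullet> b = R * (x \<bullet> b / R - u (k b))"
            using R(1) by (simp add: inner_diff_left \<eta>[OF b] right_diff_distrib)
          then have "\<bar>(x - \<eta> k) \<bullet> b\<bar> = R * \<bar>x \<bullet> b / R - u (k b)\<bar>"
            using R(1) by (simp add: abs_mult)
          then show "1 + real n * \<bar>(x - \<eta> k) \<bullet> b\<bar> \<le> R * (1 + real n * \<bar>x \<bullet> b / R - u (k b)\<bar>)"
            using R(1) by (simp add: distrib_left mult.left_commute)
        qed simp
        also have "\<dots> = R ^ DIM('a) * p"
          by (simp add: p_def prod.distrib)
        finally show ?thesis .
      qed
      have depth: "1 + real n * \<bar>sqrt (t (\<eta> k) x) - sqrt (\<tau> i)\<bar> \<le> sqrt (T / 2) * (1 + real n * e)"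
      proof -
        have "t (\<eta> k) x = T / 2 * (1 - X k x)"
          using CT(2) by (simp add: X_def)
        then have "sqrt (t (\<eta> k) x) = sqrt (T / 2) * sqrt (1 - X k x)"
            "sqrt (\<tau> i) = sqrt (T / 2) * sqrt (1 - u i)"
          by (simp_all only: \<tau>_def real_sqrt_mult)
        then have "sqrt (t (\<eta> k) x) - sqrt (\<tau> i) =
            sqrt (T / 2) * (sqrt (1 - X k x) - sqrt (1 - u i))"
          by (simp only: right_diff_distrib)
        then have "\<bar>sqrt (t (\<eta> k) x) - sqrt (\<tau> i)\<bar> = sqrt (T / 2) * e"
          using CT(2) by (simp add: abs_mult e_def)
        moreover have "sqrt (T / 2) \<ge> 1" using CT(2) by simp
        ultimately show ?thesis by (simp add: distrib_left mult.left_commute)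
      qed
      have "rho S x (\<zeta> k i) \<le> \<Phi> k i x + \<Phi> k i (\<zeta> k i)"
        using norm_triangle_ineq[of "x - \<eta> k" "\<eta> k - \<zeta> k i"]
        by (simp add: rho_def \<Phi>_def norm_minus_commute)
      also have "\<dots> \<le> 2 * \<Phi> k i x"
        using \<zeta>(2)[OF x, of k i] by simp
      also have "\<Phi> k i x \<le> (1 + C) * norm (x - \<eta> k) + \<bar>sqrt (t (\<eta> k) x) - sqrt (\<tau> i)\<bar>"
        using t(4)[OF x, of "\<eta> k"] by (simp add: \<Phi>_def distrib_right)
      also have "\<dots> \<le> (1 + C) * (norm (x - \<eta> k) + \<bar>sqrt (t (\<eta> k) x) - sqrt (\<tau> i)\<bar>)"
        using CT(1) by (simp add: algebra_simps)
      finally have "real n * rho S x (\<zeta> k i) \<le> real n *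
          (2 * ((1 + C) * (norm (x - \<eta> k) + \<bar>sqrt (t (\<eta> k) x) - sqrt (\<tau> i)\<bar>)))"
        by (intro mult_left_mono) auto
      then have "1 + real n * rho S x (\<zeta> k i) \<le> 2 * (1 + C) *
          (1 + real n * norm (x - \<eta> k) + real n * \<bar>sqrt (t (\<eta> k) x) - sqrt (\<tau> i)\<bar>)"
        using CT(1) by (simp add: algebra_simps)
      also have "\<dots> \<le> 2 * (1 + C) * ((1 + real n * norm (x - \<eta> k)) *
          (1 + real n * \<bar>sqrt (t (\<eta> k) x) - sqrt (\<tau> i)\<bar>))"
        using CT(1) by (intro mult_left_mono) (auto simp: algebra_simps)
      also have "\<dots> \<le> 2 * (1 + C) * ((R ^ DIM('a) * p) * (sqrt (T / 2) * (1 + real n * e)))"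
        using CT(1) R(1) \<open>p \<ge> 1\<close> by (intro mult_left_mono mult_mono space depth) auto
      also have "\<dots> = G * (p * (1 + real n * e))"
        by (simp add: G_def mult_ac)
      finally have "(1 + real n * rho S x (\<zeta> k i)) ^ (2 * q) \<le> (G * (p * (1 + real n * e))) ^ (2 * q)"
        using rho_nonneg[of S x "\<zeta> k i"] by (intro power_mono) auto
      then show ?thesis
        by (simp only: power_mult_distrib p_def e_def prod_power_distrib)
    qed
    show ?thesis
    proof (rule regroup_partition_by_separated_centres[where I = "K \<times> {..<N}" and Q = Q
          and \<zeta> = "\<lambda>ki. \<zeta> (fst ki) (snd ki)"])
      show "finite (K \<times> {..<N})" using \<open>finite K\<close> by simp
      show "n \<ge> 1" by (rule n)
    next
      fix ki assume "ki \<in> K \<times> {..<N}"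
      then obtain k i where ki: "ki = (k, i)" "k \<in> K" "i < N" by auto
      have "(\<lambda>x. poly (c (k b)) (1 / R * (x \<bullet> b))) \<in> poly_space (1 * ((q + 1) * n))"
        if "b \<in> Basis" for b
        using that c K ki by (intro poly_space_compose poly_space_cmult poly_space_coord) auto
      then have "E k \<in> poly_space (DIM('a) * ((q + 1) * n))"
        unfolding E_def by (intro poly_space_prod) auto
      moreover have "X k \<in> poly_space 2"
        using poly_space_add[OF poly_space_const[of 1] poly_space_cmult[OF t(1)[of "\<eta> k"], of "- 2 / T"]]
        by (simp add: X_def)
      then have "(\<lambda>x. poly (c i) (X k x)) \<in> poly_space (2 * ((q + 1) * n))"
        using c ki by (intro poly_space_compose) auto
      ultimately show "Q ki \<in> poly_space ((DIM('a) + 2) * ((q + 1) * n))"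
        unfolding Q_def ki(1) fst_conv snd_conv by (rule poly_space_mult) (simp add: algebra_simps)
      show "(\<zeta> (fst ki) (snd ki)) \<in> S"
        using \<zeta>(1) ki by simp
      fix x assume "x \<in> S"
      then show "Q ki x \<ge> 0"
        using E_nonneg c_nonneg X ki by (auto simp: Q_def)
    next
      fix x assume x: "x \<in> S"
      have "(\<Sum>ki\<in>K \<times> {..<N}. Q ki x) = (\<Sum>k\<in>K. E k x * (\<Sum>i<N. poly (c i) (X k x)))"
        by (simp add: Q_def sum.cartesian_product split_def sum_distrib_left)
      also have "\<dots> = (\<Sum>k\<in>K. E k x)"
        using c_sum X[OF x] by simp
      also have "\<dots> = (\<Prod>b\<in>Basis. \<Sum>j<N. poly (c j) (x \<bullet> b / R))"
        unfolding K_def E_def by (rule prod_sum_PiE[symmetric]) auto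
      also have "\<dots> = 1"
        using c_sum x_R[OF x] by (intro prod.neutral) auto
      finally show "(\<Sum>ki\<in>K \<times> {..<N}. Q ki x) = 1" .
      define v where "v = (\<lambda>k. \<Prod>b\<in>Basis. (1 + real n * \<bar>x \<bullet> b / R - u (k b)\<bar>) ^ (2 * q))"
      define w where "w = (\<lambda>k i. (1 + real n * \<bar>sqrt (1 - X k x) - sqrt (1 - u i)\<bar>) ^ (2 * q))"
      have v: "v k \<ge> 0" for k by (auto simp: v_def intro!: prod_nonneg)
      have L: "localization_bound q \<ge> 0" by (simp add: localization_bound_def)
      have "(\<Sum>ki\<in>K \<times> {..<N}. Q ki x * (1 + real n * rho S x (\<zeta> (fst ki) (snd ki))) ^ (2 * q)) =
          (\<Sum>k\<in>K. \<Sum>i<N. E k x * poly (c i) (X k x) * (1 + real n * rho S x (\<zeta> k i)) ^ (2 * q))"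
        by (simp add: Q_def sum.cartesian_product split_def)
      also have "\<dots> \<le> (\<Sum>k\<in>K. \<Sum>i<N. E k x * poly (c i) (X k x) * (G ^ (2 * q) * (v k * w k i)))"
        unfolding v_def w_def using E_nonneg c_nonneg X x
        by (intro sum_mono mult_left_mono localization) auto
      also have "\<dots> = G ^ (2 * q) * (\<Sum>k\<in>K. E k x * v k * (\<Sum>i<N. poly (c i) (X k x) * w k i))"
        by (simp add: sum_distrib_left mult_ac)
      also have "\<dots> \<le> G ^ (2 * q) * (\<Sum>k\<in>K. E k x * v k * localization_bound q)"
        using \<open>G \<ge> 0\<close> E_nonneg x v c_end[OF X[OF x]] unfolding w_def
        by (intro mult_left_mono sum_mono) auto
      also have "\<dots> = G ^ (2 * q) * ((\<Sum>k\<in>K. E k x * v k) * localization_bound q)"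
        by (simp add: sum_distrib_right)
      also have "(\<Sum>k\<in>K. E k x * v k) = (\<Prod>b\<in>Basis. \<Sum>j<N.
          poly (c j) (x \<bullet> b / R) * (1 + real n * \<bar>x \<bullet> b / R - u j\<bar>) ^ (2 * q))"
        unfolding K_def E_def v_def prod.distrib[symmetric] by (rule prod_sum_PiE[symmetric]) auto
      also have "\<dots> \<le> (\<Prod>b\<in>(Basis :: 'a set). localization_bound q)"
        using c_inner x_R[OF x] c_nonneg by (intro prod_mono conjI sum_nonneg) auto
      finally show "(\<Sum>ki\<in>K \<times> {..<N}. Q ki x *
          (1 + real n * rho S x (\<zeta> (fst ki) (snd ki))) ^ (2 * q)) \<le> A"
        using \<open>G \<ge> 0\<close> L by (simp add: A_def mult_left_mono mult_right_mono)
    qed (rule rho_self rho_commute rho_triangle rho_nonneg)+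
  qed
  then show ?thesis by blast
qed


section \<open>Polynomial partitions of unity on the domain\<close>

theorem theorem1p12:
  fixes l :: real
  assumes "l > 1"
  shows "\<exists>c0::nat. \<forall>D \<Omega> :: ((real^'d::finite) \<times> real) set.
           C2_domain D \<and> \<Omega> = closure D \<longrightarrow>
           (\<exists>C1::real. \<forall>n::nat. n \<ge> 1 \<longrightarrow>
             (\<exists>(m::nat) \<xi> P.
                inj_on \<xi> {1..m} \<and> \<xi> ` {1..m} \<subseteq> \<Omega> \<and>
                separated_set (rho \<Omega>) (1 / real n) (\<xi> ` {1..m}) \<and>
                (\<forall>j\<in>{1..m}. P j \<in> poly_space (c0 * n)) \<and>
                (\<forall>x\<in>\<Omega>. (\<Sum>j=1..m. P j x) = 1 \<and>
                   (\<forall>j\<in>{1..m}. \<bar>P j x\<bar> \<le> C1 * (1 + real n * rho \<Omega> x (\<xi> j)) powr (- l)))))"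
proof -
  \<comment> \<open>The exponent \<open>l\<close> is rounded up to an even integer \<open>2 * q\<close>; \<open>c0\<close> counts \<open>q + 1\<close> for each
    coordinate and twice that for the quadratic substitution.\<close>
  define q where "q = nat \<lceil>l\<rceil>"
  have q: "l \<le> real (2 * q)" using assms by (simp add: q_def) linarith
  define c0 where "c0 = (DIM((real^'d) \<times> real) + 2) * (q + 1)"
  have decay: "p \<le> C * w powr (- l)" if "p * w ^ (2 * q) \<le> C" "w \<ge> 1" "p \<ge> 0" for p w C :: real
  proof -
    have "w powr l \<le> w powr real (2 * q)"
      using that(2) q by (rule powr_mono[rotated])
    also have "\<dots> = w ^ (2 * q)"
      using that(2) by (subst powr_realpow) auto
    finally have "p * w powr l \<le> p * w ^ (2 * q)"
      using that(3) by (rule mult_left_mono)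
    then have "p * w powr l \<le> C" using that(1) by linarith
    then show ?thesis
      using that(2) by (simp add: powr_minus field_simps)
  qed
  show ?thesis
  proof (intro exI[of _ c0] allI impI, elim conjE)
    fix D \<Omega> :: "((real^'d) \<times> real) set"
    assume D: "C2_domain D" and \<Omega>: "\<Omega> = closure D"
    obtain r where "r > 0" "two_sided_ball_condition r \<Omega>"
      using C2_domain_two_sided_ball_condition[OF D] two_sided_ball_condition_closure \<Omega> by blast
    moreover have compact: "compact \<Omega>" "\<Omega> \<noteq> {}"
      using D \<Omega> by (auto simp: C2_domain_def compact_closure)
    ultimately obtain C T where CT: "C \<ge> 0" "T \<ge> 2" "\<And>y. \<exists>t\<in>poly_space 2. \<forall>x\<in>\<Omega>. 0 \<le> t x \<and> t x \<le> T \<and>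
        \<bar>sqrt (t x) - sqrt (infdist x (frontier \<Omega>))\<bar> \<le> C * norm (x - y)"
      using sqrt_dist_quadratic_models[of r \<Omega>] by blast
    obtain C1 where C1: "\<forall>n\<ge>1. \<exists>(m::nat) \<xi> P. inj_on \<xi> {1..m} \<and> \<xi> ` {1..m} \<subseteq> \<Omega> \<and>
        separated_set (rho \<Omega>) (1 / real n) (\<xi> ` {1..m}) \<and>
        (\<forall>j\<in>{1..m}. P j \<in> poly_space ((DIM((real^'d) \<times> real) + 2) * ((q + 1) * n))) \<and>
        (\<forall>x\<in>\<Omega>. (\<Sum>j=1..m. P j x) = 1 \<and>
          (\<forall>j\<in>{1..m}. \<bar>P j x\<bar> * (1 + real n * rho \<Omega> x (\<xi> j)) ^ (2 * q) \<le> C1))"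
      using localized_partition_from_quadratic_models[OF compact CT, of q] by (elim exE) (rule that)
    show "\<exists>C1::real. \<forall>n::nat. n \<ge> 1 \<longrightarrow> (\<exists>(m::nat) \<xi> P.
        inj_on \<xi> {1..m} \<and> \<xi> ` {1..m} \<subseteq> \<Omega> \<and>
        separated_set (rho \<Omega>) (1 / real n) (\<xi> ` {1..m}) \<and>
        (\<forall>j\<in>{1..m}. P j \<in> poly_space (c0 * n)) \<and>
        (\<forall>x\<in>\<Omega>. (\<Sum>j=1..m. P j x) = 1 \<and>
           (\<forall>j\<in>{1..m}. \<bar>P j x\<bar> \<le> C1 * (1 + real n * rho \<Omega> x (\<xi> j)) powr (- l))))"
    proof (intro exI[of _ C1] allI impI)
      fix n :: nat assume "n \<ge> 1"
      obtain m :: nat and \<xi> P where P: "inj_on \<xi> {1..m}" "\<xi> ` {1..m} \<subseteq> \<Omega>"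
        "separated_set (rho \<Omega>) (1 / real n) (\<xi> ` {1..m})"
        "\<forall>j\<in>{1..m}. P j \<in> poly_space ((DIM((real^'d) \<times> real) + 2) * ((q + 1) * n))"
        "\<forall>x\<in>\<Omega>. (\<Sum>j=1..m. P j x) = 1 \<and>
          (\<forall>j\<in>{1..m}. \<bar>P j x\<bar> * (1 + real n * rho \<Omega> x (\<xi> j)) ^ (2 * q) \<le> C1)"
        using C1[rule_format, OF \<open>n \<ge> 1\<close>] by (elim exE conjE) (rule that)
      have "\<bar>P j x\<bar> \<le> C1 * (1 + real n * rho \<Omega> x (\<xi> j)) powr (- l)"
        if "x \<in> \<Omega>" "j \<in> {1..m}" for x j
        using P(5) that rho_nonneg[of \<Omega> x "\<xi> j"] by (intro decay) auto
      moreover have "\<forall>j\<in>{1..m}. P j \<in> poly_space (c0 * n)"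
        using P(4) by (simp only: c0_def mult.assoc)
      ultimately have "inj_on \<xi> {1..m} \<and> \<xi> ` {1..m} \<subseteq> \<Omega> \<and>
        separated_set (rho \<Omega>) (1 / real n) (\<xi> ` {1..m}) \<and>
        (\<forall>j\<in>{1..m}. P j \<in> poly_space (c0 * n)) \<and>
        (\<forall>x\<in>\<Omega>. (\<Sum>j=1..m. P j x) = 1 \<and>
           (\<forall>j\<in>{1..m}. \<bar>P j x\<bar> \<le> C1 * (1 + real n * rho \<Omega> x (\<xi> j)) powr (- l)))"
        using P(1-3,5) by blast
      then show "\<exists>(m::nat) \<xi> P.
        inj_on \<xi> {1..m} \<and> \<xi> ` {1..m} \<subseteq> \<Omega> \<and>
        separated_set (rho \<Omega>) (1 / real n) (\<xi> ` {1..m}) \<and>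
        (\<forall>j\<in>{1..m}. P j \<in> poly_space (c0 * n)) \<and>
        (\<forall>x\<in>\<Omega>. (\<Sum>j=1..m. P j x) = 1 \<and>
           (\<forall>j\<in>{1..m}. \<bar>P j x\<bar> \<le> C1 * (1 + real n * rho \<Omega> x (\<xi> j)) powr (- l)))"
        by (intro exI)
    qed
  qed
qed

end
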